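(* Let $f\in\mathcal{S}_\kappa$ be defined on $\mathbb{D}\setminus\Lambda$ with $\Lambda$ discrete, and let $\tilde f$ be its (unique) extension to a standard function, which has $q$ poles (counted with multiplicity) and some jumps, all jumps lying in $\mathbb{D}\setminus\Lambda$. Then for every nonempty open set $\Omega\subseteq\mathbb{D}\setminus\Lambda$ there exists a positive integer $n$ such that $$\mathbf{k}_n(f;\Omega)=q+\ell_\Omega,$$ where $\ell_\Omega$ is the number of jumps of $\tilde f$ belonging to $\Omega$ and $\mathbf{k}_n(f;\Omega)=\max_{z_1,\dots,z_n\in\Omega\ \text{distinct}}\mathrm{sq}_-P_n(f;z_1,\dots,z_n)$.
   Context: $\mathbb{D}$ is the open unit disk; a set $\Lambda\subset\mathbb{D}$ is discrete if at most countable with accumulation points only on the unit circle. A Schur function is an analytic $S:\mathbb{D}\to\mathbb{C}$ with $|S|\le1$; a Blaschke product is a rational function analytic on $\mathbb{D}$ and unimodular on the unit circle, its degree being its number of zeros in $\mathbb{D}$ with multiplicity. Pick matrix: $P_n(f;z_1,\dots,z_n)=\left[\frac{1-f(z_i)\overline{f(z_j)}}{1-z_i\overline{z_j}}\right]_{i,j=1}^n$. $\mathrm{sq}_-P$ = number of negative eigenvalues (with multiplicity). $\mathcal{S}_\kappa$: functions on $\mathbb{D}\setminus\Lambda$ ($\Lambda$ discrete) all of whose Pick matrices at distinct points have at most $\kappa$ negative eigenvalues, at least one having exactly $\kappa$. A standard function is $f(z)=S(z)/B(z)$ for $z\notin\mathcal{W}\cup\mathcal{Z}$, $f(z_j)=\gamma_j$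 for $z_j\in\mathcal{Z}$, where $\mathcal{Z}=\{z_1,\dots,z_\ell\}$, $\mathcal{W}$ are disjoint finite sets of distinct points of $\mathbb{D}$; $B$ a Blaschke product of degree $q$, $S$ a Schur function, $\mathcal{W}\subseteq Z(B)\subseteq\mathcal{W}\cup\mathcal{Z}$, $Z(B)\cap Z(S)=\emptyset$; and $S(z_j)/B(z_j)\neq\gamma_j$ if $z_j\notin Z(B)$. Its domain is $\mathbb{D}\setminus\mathcal{W}$; its poles are the zeros of $B$ (with multiplicity) and its jumps are $z_1,\dots,z_\ell$. It is known (and may be assumed) that every $f\in\mathcal{S}_\kappa$ has a unique extension to a standard function whose jumps lie in $\mathbb{D}\setminus\Lambda$. *)

theory Defs
  imports "HOL-Complex_Analysis.Complex_Analysis" "Jordan_Normal_Form.Char_Poly"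
begin

definition sq_neg :: "complex mat \<Rightarrow> nat" where
  "sq_neg A = (\<Sum>a\<in>{a. eigenvalue A a \<and> a \<in> \<real> \<and> Re a < 0}. order a (char_poly A))"

definition pick_matrix :: "(complex \<Rightarrow> complex) \<Rightarrow> complex list \<Rightarrow> complex mat" where
  "pick_matrix f zs = mat (length zs) (length zs)
     (\<lambda>(i,j). (1 - f (zs!i) * cnj (f (zs!j))) / (1 - zs!i * cnj (zs!j)))"

definition disc :: "complex set" where "disc = ball 0 1"

definition discrete_in_disc :: "complex set \<Rightarrow> bool" where
  "discrete_in_disc L \<longleftrightarrow> L \<subseteq> disc \<and> countable L \<and> (\<forall>z\<in>disc. \<not> z islimpt L)"

definition in_S_kappa :: "nat \<Rightarrow> complex set \<Rightarrow> (complex \<Rightarrow> complex) \<Rightarrow> bool" where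
  "in_S_kappa \<kappa> L f \<longleftrightarrow>
     (\<forall>zs. zs \<noteq> [] \<and> distinct zs \<and> set zs \<subseteq> disc - L \<longrightarrow> sq_neg (pick_matrix f zs) \<le> \<kappa>) \<and>
     (\<exists>zs. zs \<noteq> [] \<and> distinct zs \<and> set zs \<subseteq> disc - L \<and> sq_neg (pick_matrix f zs) = \<kappa>)"

definition schur_function :: "(complex \<Rightarrow> complex) \<Rightarrow> bool" where
  "schur_function S \<longleftrightarrow> S holomorphic_on disc \<and> (\<forall>z\<in>disc. cmod (S z) \<le> 1)"

definition blaschke :: "(complex \<Rightarrow> complex) \<Rightarrow> bool" where
  "blaschke B \<longleftrightarrow> (\<exists>p q :: complex poly. coprime p q \<and>
      (\<forall>z\<in>disc. poly q z \<noteq> 0) \<and>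
      (\<forall>z. cmod z = 1 \<and> poly q z \<noteq> 0 \<longrightarrow> cmod (poly p z / poly q z) = 1) \<and>
      (\<forall>z\<in>disc. B z = poly p z / poly q z))"

definition zero_set :: "(complex \<Rightarrow> complex) \<Rightarrow> complex set" where
  "zero_set g = {z\<in>disc. g z = 0}"

definition blaschke_degree :: "(complex \<Rightarrow> complex) \<Rightarrow> nat" where
  "blaschke_degree B = (\<Sum>a\<in>zero_set B. nat (zorder B a))"

text \<open>g is a standard function with data S, B, jumps Zs with values \<gamma>, and set W
  (domain D - W); g is described on its domain D - W.\<close>
definition standard_function ::
  "(complex \<Rightarrow> complex) \<Rightarrow> (complex \<Rightarrow> complex) \<Rightarrow> (complex \<Rightarrow> complex) \<Rightarrow>
   complex set \<Rightarrow> (complex \<Rightarrow> complex) \<Rightarrow> complex set \<Rightarrow> bool" where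
  "standard_function g S B Zs \<gamma> W \<longleftrightarrow>
     finite Zs \<and> finite W \<and> Zs \<subseteq> disc \<and> W \<subseteq> disc \<and> Zs \<inter> W = {} \<and>
     blaschke B \<and> schur_function S \<and>
     W \<subseteq> zero_set B \<and> zero_set B \<subseteq> W \<union> Zs \<and> zero_set B \<inter> zero_set S = {} \<and>
     (\<forall>z\<in>Zs. z \<notin> zero_set B \<longrightarrow> S z / B z \<noteq> \<gamma> z) \<and>
     (\<forall>z\<in>disc - W. g z = (if z \<in> Zs then \<gamma> z else S z / B z))"

definition k_n :: "nat \<Rightarrow> (complex \<Rightarrow> complex) \<Rightarrow> complex set \<Rightarrow> nat" where
  "k_n n f \<Omega> = Max {sq_neg (pick_matrix f zs) | zs. length zs = n \<and> distinct zs \<and> set zs \<subseteq> \<Omega>}"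

end

theory Submission
  imports Defs
begin

text \<open>
  Expanding \<open>1 / (1 - z cnj w)\<close> as a geometric series, the Pick form of a finite measure with
  masses \<open>c x\<close> is \<open>\<Sum>m. |U m|^2 - |V m|^2\<close>, where \<open>U m = \<Sum>x. c x * x^m\<close> and
  \<open>V m = \<Sum>x. c x * f x * x^m\<close>.

  Upper bound: away from the jumps the Pick kernel of \<open>S / B\<close> is, up to a diagonal congruence, the
  Pick kernel of \<open>S\<close> (positive) minus that of \<open>B\<close> (of rank \<open>q\<close>), and deleting the jumps costs at
  most one negative square each.

  Lower bound: for a zero \<open>a\<close> of \<open>B\<close> of order \<open>r\<close> consider the Taylor functionals
  \<open>F \<mapsto> F^(i)(a) / i!\<close> with \<open>i < r\<close>, and at a jump also \<open>i = r\<close>, corrected by a point mass at \<open>a\<close>.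
  They annihilate all \<open>z^m * B\<close>, so \<open>U = 0\<close>, while the sequences \<open>V\<close> they produce from
  \<open>z^m * S\<close> and the jump values are linearly independent: the form is negative definite on a space of
  dimension \<open>q + \<ell>\<close>. By a Runge argument each functional is a limit, in the norm dual to the
  supremum over a circle of radius \<open>R < 1\<close>, of combinations of point evaluations in \<open>\<Omega>\<close> off the
  jumps, and negative definiteness survives a small perturbation.
\<close>

section \<open>Linear algebra\<close>

text \<open>The obstacle is location: poles may lie anywhere in the disc, even outside the domain of
  \<open>f\<close>, while nodes are allowed only in \<open>\<Omega>\<close>. The device that removes
  it is a weight. A mass \<open>d w * B w\<close> at \<open>w\<close> contributes \<open>d w\<close>
  times the value of \<open>z^m * B\<close> at \<open>w\<close> to \<open>U m\<close> and, because
  \<open>B * f = S\<close> off the jumps, \<open>d w\<close> times the value of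
  \<open>z^m * S\<close> to \<open>V m\<close>. Both functions are holomorphic in the whole disc, so
  the singularities of \<open>f\<close> are never touched and the functionals can be moved from a
  pole into \<open>\<Omega>\<close>. Independence of the sequences \<open>V\<close> rests on the two
  nondegeneracy conditions of a standard function: \<open>S\<close> does not vanish at the zeros of
  \<open>B\<close>, and at a jump elsewhere the value is not \<open>S / B\<close>. A second obstacle
  is that \<open>sq_neg\<close> counts roots of a characteristic polynomial; Hermitian
  diagonalisation turns it into statements about the sign of a form on subspaces. The number of
  nodes is whatever the approximation happens to need. Since the upper bound holds for lists of
  every length, that number can serve as \<open>n\<close>.\<close>

lemma homogeneous_system_nontrivial_solution:
  fixes a :: "'m \<Rightarrow> 'i \<Rightarrow> 'a::field"
  assumes "finite M" "finite I" "card M < card I"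
  shows "\<exists>x. (\<exists>i\<in>I. x i \<noteq> 0) \<and> (\<forall>m\<in>M. (\<Sum>i\<in>I. a m i * x i) = 0)"
  using assms
proof (induction M arbitrary: a I rule: finite_induct)
  case empty
  then have "I \<noteq> {}" by auto
  then show ?case by (intro exI[of _ "\<lambda>_. 1"]) auto
next
  case (insert m M)
  show ?case
  proof (cases "\<forall>i\<in>I. a m i = 0")
    case True
    have "card M < card I" using insert by simp
    from insert.IH[OF insert.prems(1) this, of a] True show ?thesis by auto
  next
    case False
    then obtain i0 where i0: "i0 \<in> I" "a m i0 \<noteq> 0" by blast
    \<comment> \<open>Elimination of the unknown \<open>i0\<close>, with equation \<open>m\<close>
      as pivot row.\<close>
    define a' where "a' = (\<lambda>m' i. a m' i - a m' i0 * a m i / a m i0)"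
    have "finite (I - {i0})" "card M < card (I - {i0})"
      using insert i0 by (auto simp: card_Diff_singleton)
    from insert.IH[OF this, of a'] obtain x where
      x: "\<exists>i\<in>I - {i0}. x i \<noteq> 0" "\<And>m'. m' \<in> M \<Longrightarrow> (\<Sum>i\<in>I - {i0}. a' m' i * x i) = 0" by blast
    define s where "s = (\<Sum>i\<in>I - {i0}. a m i * x i)"
    define y where "y = x(i0 := - s / a m i0)"
    have split: "(\<Sum>i\<in>I. b i * y i) = (\<Sum>i\<in>I - {i0}. b i * x i) - b i0 * s / a m i0" for b
      using insert.prems(1) i0 by (simp add: sum.remove[of I i0] y_def)
    have "(\<Sum>i\<in>I. a m' i * y i) = 0" if "m' \<in> insert m M" for m'
    proof (cases "m' = m")
      case True
      then show ?thesis using i0 by (simp add: split s_def)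
    next
      case False
      then have "(\<Sum>i\<in>I - {i0}. a m' i * x i - a m' i0 / a m i0 * (a m i * x i)) = 0"
        using x(2)[of m'] that unfolding a'_def by (simp add: algebra_simps)
      then show ?thesis
        unfolding split s_def sum_subtractf sum_distrib_left[symmetric] by simp
    qed
    moreover have "\<exists>i\<in>I. y i \<noteq> 0" using x(1) by (auto simp: y_def)
    ultimately show ?thesis by blast
  qed
qed

text \<open>Injectivity made quantitative, with a constant independent of \<open>x\<close>: this is
  what lets strict negativity survive when the limiting functionals are replaced by approximations.
  The constant is produced by Gaussian elimination on the unknowns.\<close>

lemma trivial_kernel_bound:
  fixes a :: "'m \<Rightarrow> 'i \<Rightarrow> 'a::real_normed_field"
  assumes "finite M" "finite I"
    and "\<And>x. (\<forall>m\<in>M. (\<Sum>i\<in>I. a m i * x i) = 0) \<Longrightarrow> \<forall>i\<in>I. x i = 0"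
  shows "\<exists>K>0. \<forall>x. (\<Sum>i\<in>I. norm (x i)) \<le> K * (\<Sum>m\<in>M. norm (\<Sum>i\<in>I. a m i * x i))"
  using assms(2,3)
proof (induction I arbitrary: a rule: finite_induct)
  case empty
  then show ?case by (intro exI[of _ 1]) auto
next
  case (insert i0 I)
  note fM = assms(1)
  have sumI: "(\<Sum>i\<in>insert i0 I. b i) = b i0 + (\<Sum>i\<in>I. b i)" for b :: "'i \<Rightarrow> 'a"
    using insert by simp
  have "\<exists>m\<in>M. a m i0 \<noteq> 0"
  proof (rule ccontr)
    assume "\<not> ?thesis"
    moreover have "(\<Sum>i\<in>insert i0 I. a m i * (if i = i0 then 1 else 0)) = a m i0" for m
      using insert by (subst sumI) (auto intro!: sum.neutral)
    ultimately have "\<forall>i\<in>insert i0 I. (if i = i0 then 1 else 0) = (0::'a)"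
      by (intro insert.prems) auto
    then show False by auto
  qed
  then obtain m0 where m0: "m0 \<in> M" "a m0 i0 \<noteq> 0" by blast
  define t where "t = (\<lambda>m. a m i0 / a m0 i0)"
  define a' where "a' = (\<lambda>m i. a m i - t m * a m0 i)"
  have a': "(\<Sum>i\<in>I. a' m i * x i) =
      (\<Sum>i\<in>insert i0 I. a m i * x i) - t m * (\<Sum>i\<in>insert i0 I. a m0 i * x i)" for m x
  proof -
    have "(\<Sum>i\<in>I. a' m i * x i) = (\<Sum>i\<in>I. a m i * x i) - t m * (\<Sum>i\<in>I. a m0 i * x i)"
      unfolding a'_def sum_distrib_left sum_subtractf[symmetric]
      by (intro sum.cong) (auto simp: algebra_simps)
    then show ?thesis using m0 unfolding sumI t_def by (simp add: field_simps)
  qed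
  have "\<exists>K>0. \<forall>x. (\<Sum>i\<in>I. norm (x i)) \<le> K * (\<Sum>m\<in>M. norm (\<Sum>i\<in>I. a' m i * x i))"
  proof (rule insert.IH)
    fix x assume x: "\<forall>m\<in>M. (\<Sum>i\<in>I. a' m i * x i) = 0"
    \<comment> \<open>The value at \<open>i0\<close> solves equation \<open>m0\<close>, so a kernel
      vector of the reduced system extends to one of the full system.\<close>
    define y where "y = x(i0 := - (\<Sum>i\<in>I. a m0 i * x i) / a m0 i0)"
    have xy: "(\<Sum>i\<in>I. b i * y i) = (\<Sum>i\<in>I. b i * x i)" for b
      using insert.hyps by (intro sum.cong) (auto simp: y_def)
    have z: "(\<Sum>i\<in>insert i0 I. a m0 i * y i) = 0"
      using m0 unfolding sumI xy by (simp add: y_def)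
    have "(\<Sum>i\<in>insert i0 I. a m i * y i) = 0" if "m \<in> M" for m
      using a'[of m y] x that unfolding xy z by simp
    then have "\<forall>i\<in>insert i0 I. y i = 0" by (intro insert.prems) auto
    then show "\<forall>i\<in>I. x i = 0" using insert.hyps by (auto simp: y_def split: if_splits)
  qed
  then obtain K where K: "K > 0"
    "\<And>x. (\<Sum>i\<in>I. norm (x i)) \<le> K * (\<Sum>m\<in>M. norm (\<Sum>i\<in>I. a' m i * x i))" by blast
  define \<tau> where "\<tau> = (\<Sum>m\<in>M. norm (t m))"
  define \<alpha> where "\<alpha> = (\<Sum>i\<in>I. norm (a m0 i))"
  define \<beta> where "\<beta> = norm (a m0 i0)"
  have pos: "\<tau> \<ge> 0" "\<alpha> \<ge> 0" "\<beta> > 0" using m0 by (auto simp: \<tau>_def \<alpha>_def \<beta>_def intro: sum_nonneg)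
  \<comment> \<open>Back substitution, in the notation \<open>X\<close>, \<open>Y\<close> below: the
    reduced system gives \<open>X \<le> K * (1 + \<tau>) * Y\<close>, equation \<open>m0\<close>
    gives \<open>\<beta> * norm (x i0) \<le> Y + \<alpha> * X\<close>, and \<open>K'\<close> adds
    the two bounds, with \<open>\<alpha>\<close> enlarged to \<open>1 + \<alpha>\<close>.\<close>
  define K' where "K' = (1 + \<alpha>) / \<beta> * (K * (1 + \<tau>)) + 1 / \<beta> + K * (1 + \<tau>)"
  have "0 \<le> K * (1 + \<tau>)" "0 \<le> (1 + \<alpha>) / \<beta> * (K * (1 + \<tau>))" "0 < 1 / \<beta>"
    using pos K(1) by simp_all
  then have "K' > 0" unfolding K'_def by linarith
  moreover have "(\<Sum>i\<in>insert i0 I. norm (x i)) \<le> K' * (\<Sum>m\<in>M. norm (\<Sum>i\<in>insert i0 I. a m i * x i))" for x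
  proof -
    define V where "V = (\<lambda>m. \<Sum>i\<in>insert i0 I. a m i * x i)"
    have V: "(\<Sum>i\<in>insert i0 I. a m i * x i) = V m" for m by (simp only: V_def)
    define X where "X = (\<Sum>i\<in>I. norm (x i))"
    define Y where "Y = (\<Sum>m\<in>M. norm (V m))"
    have Y0: "norm (V m0) \<le> Y" unfolding Y_def using fM m0 by (intro member_le_sum) auto
    have Y00: "0 \<le> Y" unfolding Y_def by (intro sum_nonneg) auto
    have X00: "0 \<le> X" unfolding X_def by (intro sum_nonneg) auto
    have "(\<Sum>m\<in>M. norm (\<Sum>i\<in>I. a' m i * x i)) \<le> (\<Sum>m\<in>M. norm (V m) + norm (t m) * norm (V m0))"
      unfolding a' V
      by (intro sum_mono order_trans[OF norm_triangle_ineq4]) (simp add: norm_mult)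
    also have "\<dots> = Y + \<tau> * norm (V m0)" by (simp add: Y_def \<tau>_def sum.distrib sum_distrib_right)
    also have "\<dots> \<le> (1 + \<tau>) * Y" using mult_left_mono[OF Y0 pos(1)] by (simp add: algebra_simps)
    finally have "X \<le> K * ((1 + \<tau>) * Y)"
      using K(2)[of x] K(1) unfolding X_def by (meson mult_left_mono less_imp_le order_trans)
    then have X1: "X \<le> K * (1 + \<tau>) * Y" by (simp add: algebra_simps)
    have "a m0 i0 * x i0 = V m0 - (\<Sum>i\<in>I. a m0 i * x i)" unfolding V_def sumI by simp
    then have "\<beta> * norm (x i0) \<le> norm (V m0) + norm (\<Sum>i\<in>I. a m0 i * x i)"
      unfolding \<beta>_def norm_mult[symmetric] by (simp add: norm_triangle_ineq4)
    also have "norm (\<Sum>i\<in>I. a m0 i * x i) \<le> (\<Sum>i\<in>I. \<alpha> * norm (x i))"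
    proof (rule sum_norm_le)
      fix i assume "i \<in> I"
      then have "norm (a m0 i) \<le> \<alpha>" unfolding \<alpha>_def using insert.hyps by (intro member_le_sum) auto
      then show "norm (a m0 i * x i) \<le> \<alpha> * norm (x i)" by (simp add: norm_mult mult_right_mono)
    qed
    also have "\<dots> = \<alpha> * X" by (simp add: X_def sum_distrib_left)
    finally have "\<beta> * norm (x i0) \<le> Y + \<alpha> * X" using Y0 by simp
    also have "\<dots> \<le> Y + (1 + \<alpha>) * (K * (1 + \<tau>) * Y)"
      using X1 X00 pos by (intro add_left_mono mult_mono) auto
    finally have "norm (x i0) \<le> (Y + (1 + \<alpha>) * (K * (1 + \<tau>) * Y)) / \<beta>"
      using pos by (simp add: field_simps)
    then have "norm (x i0) + X \<le> K' * Y" using X1 unfolding K'_def by (simp add: field_simps add_divide_distrib)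
    then show ?thesis using insert.hyps by (simp add: X_def Y_def V_def)
  qed
  ultimately show ?case by blast
qed

text \<open>Inductive step of the spectral theorem, done without a matrix for the restricted
  operator. A vector orthogonal to the known eigenvectors has its whole orbit under \<open>A\<close>
  in their orthogonal complement, because \<open>A\<close> is Hermitian. A polynomial of least
  degree annihilating this vector has a root \<open>\<nu>\<close>; the cofactor of the linear
  factor, applied to the vector, is an eigenvector in the complement.\<close>

lemma eigenvector_orthogonal_to_eigenvectors:
  fixes A :: "nat \<Rightarrow> nat \<Rightarrow> complex"
  assumes herm: "\<And>i j. i < n \<Longrightarrow> j < n \<Longrightarrow> A j i = cnj (A i j)"
    and "m < n"
    and eig: "\<And>k i. k < m \<Longrightarrow> i < n \<Longrightarrow> (\<Sum>j<n. A i j * u k j) = of_real (\<mu> k) * u k i"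
  shows "\<exists>z \<nu>. (\<exists>i<n. z i \<noteq> 0) \<and> (\<forall>i<n. (\<Sum>j<n. A i j * z j) = \<nu> * z i) \<and>
           (\<forall>k<m. (\<Sum>i<n. z i * cnj (u k i)) = 0)"
proof -
  have "card {..<m} < card {..<n}" using \<open>m < n\<close> by simp
  from homogeneous_system_nontrivial_solution[OF _ _ this, of "\<lambda>k i. cnj (u k i)"] obtain y where
    y: "\<exists>i<n. y i \<noteq> 0" "\<And>k. k < m \<Longrightarrow> (\<Sum>i<n. y i * cnj (u k i)) = 0"
    by (auto simp: mult.commute)
  define T where "T = (\<lambda>x i. \<Sum>j<n. A i j * x j)"
  define v where "v = (\<lambda>k. (T ^^ k) y)"
  have v0: "v 0 = y" and vS: "v (Suc k) i = (\<Sum>j<n. A i j * v k j)" for k i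
    by (simp_all add: v_def T_def)
  have orth: "(\<Sum>i<n. v k i * cnj (u l i)) = 0" if "l < m" for k l
  proof (induction k)
    case 0
    then show ?case using y(2) that v0 by simp
  next
    case (Suc k)
    have "(\<Sum>i<n. v (Suc k) i * cnj (u l i)) = (\<Sum>i<n. \<Sum>j<n. A i j * v k j * cnj (u l i))"
      by (simp add: vS sum_distrib_right)
    also have "\<dots> = (\<Sum>j<n. \<Sum>i<n. A i j * v k j * cnj (u l i))" by (rule sum.swap)
    also have "\<dots> = (\<Sum>j<n. v k j * cnj (\<Sum>i<n. A j i * u l i))"
      unfolding cnj_sum sum_distrib_left
    proof (intro sum.cong[OF refl])
      fix j i assume "i \<in> {..<n}" "j \<in> {..<n}"
      then have "A i j = cnj (A j i)" by (intro herm) auto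
      then show "A i j * v k j * cnj (u l i) = v k j * cnj (A j i * u l i)" by simp
    qed
    also have "\<dots> = (\<Sum>j<n. v k j * cnj (of_real (\<mu> l) * u l j))"
      using eig[OF that] by (intro sum.cong) auto
    also have "\<dots> = of_real (\<mu> l) * (\<Sum>j<n. v k j * cnj (u l j))"
      by (simp add: sum_distrib_left algebra_simps)
    finally show ?case using Suc by simp
  qed
  \<comment> \<open>\<open>ev p\<close> is the vector \<open>p(A) y\<close>, and
    \<open>bad p\<close> says that \<open>p\<close> is nonzero and annihilates
    \<open>y\<close>.\<close>
  define ev where "ev = (\<lambda>p i. \<Sum>k\<le>degree p. coeff p k * v k i)"
  have ev_le: "ev p i = (\<Sum>k\<le>N. coeff p k * v k i)" if "degree p \<le> N" for p i N
    unfolding ev_def using that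
    by (intro sum.mono_neutral_left) (auto simp: coeff_eq_0)
  define bad where "bad = (\<lambda>p. p \<noteq> 0 \<and> (\<forall>i<n. ev p i = 0))"
  have "\<exists>p. bad p"
  proof -
    have "card {..<n} < card {..n}" by simp
    from homogeneous_system_nontrivial_solution[OF _ _ this, of "\<lambda>i k. v k i"] obtain x where
      x: "\<exists>k\<le>n. x k \<noteq> 0" "\<And>i. i < n \<Longrightarrow> (\<Sum>k\<le>n. v k i * x k) = 0" by auto
    define p where "p = (\<Sum>k\<le>n. monom (x k) k)"
    have cp: "coeff p k = (if k \<le> n then x k else 0)" for k
      by (simp add: p_def coeff_sum)
    have "p \<noteq> 0" using x(1) cp by (metis coeff_0)
    moreover have "degree p \<le> n" by (intro degree_le) (simp add: cp)
    ultimately show ?thesis using x(2) unfolding bad_def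
      by (intro exI[of _ p]) (auto simp: ev_le cp mult.commute)
  qed
  then obtain p where p: "bad p" "\<And>q. bad q \<Longrightarrow> degree p \<le> degree q"
    using ex_has_least_nat[of bad _ degree] by metis
  have "degree p \<noteq> 0"
  proof
    assume "degree p = 0"
    then obtain c where "p = [:c:]" by (rule degree_eq_zeroE)
    then show False using p(1) y(1) unfolding bad_def by (auto simp: ev_def v0)
  qed
  then obtain \<nu> where "poly p \<nu> = 0"
    using fundamental_theorem_of_algebra[of p] by (auto simp: constant_degree)
  then obtain q where q: "p = [:-\<nu>, 1:] * q" by (metis poly_eq_0_iff_dvd dvdE)
  have "q \<noteq> 0" using q p(1) by (auto simp: bad_def)
  then have dq: "degree p = Suc (degree q)" unfolding q by (subst degree_mult_eq) auto
  have "\<not> bad q" using p(2)[of q] dq by auto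
  then have nz: "\<exists>i<n. ev q i \<noteq> 0" using \<open>q \<noteq> 0\<close> by (auto simp: bad_def)
  \<comment> \<open>The identity \<open>(A - \<nu>) q(A) y = p(A) y = 0\<close>, read off
    coefficientwise.\<close>
  have "(\<Sum>j<n. A i j * ev q j) = \<nu> * ev q i" if "i < n" for i
  proof -
    define N where "N = degree q"
    have "0 = ev p i" using p(1) that by (simp add: bad_def)
    also have "\<dots> = (\<Sum>k\<le>Suc N. coeff p k * v k i)"
      by (intro ev_le) (simp add: dq N_def)
    also have "\<dots> = (\<Sum>k\<le>Suc N. coeff (pCons 0 q) k * v k i) - \<nu> * (\<Sum>k\<le>Suc N. coeff q k * v k i)"
      unfolding sum_distrib_left sum_subtractf[symmetric]
      by (intro sum.cong) (auto simp: q algebra_simps)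
    also have "(\<Sum>k\<le>Suc N. coeff (pCons 0 q) k * v k i) = (\<Sum>k\<le>N. coeff q k * v (Suc k) i)"
      unfolding sum.atMost_Suc_shift by simp
    also have "\<dots> = (\<Sum>k\<le>N. \<Sum>j<n. A i j * (coeff q k * v k j))"
      unfolding vS sum_distrib_left by (intro sum.cong) auto
    also have "\<dots> = (\<Sum>j<n. \<Sum>k\<le>N. A i j * (coeff q k * v k j))" by (rule sum.swap)
    also have "\<dots> = (\<Sum>j<n. A i j * ev q j)" unfolding ev_def N_def by (simp add: sum_distrib_left)
    also have "(\<Sum>k\<le>Suc N. coeff q k * v k i) = ev q i"
      by (rule ev_le[symmetric]) (simp add: N_def)
    finally show ?thesis by simp
  qed
  moreover have "(\<Sum>i<n. ev q i * cnj (u k i)) = 0" if "k < m" for k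
  proof -
    have "(\<Sum>i<n. ev q i * cnj (u k i)) = (\<Sum>i<n. \<Sum>l\<le>degree q. coeff q l * (v l i * cnj (u k i)))"
      unfolding ev_def sum_distrib_right by (simp add: mult.assoc)
    also have "\<dots> = (\<Sum>l\<le>degree q. \<Sum>i<n. coeff q l * (v l i * cnj (u k i)))" by (rule sum.swap)
    also have "\<dots> = 0" using orth[OF that] by (simp add: sum_distrib_left[symmetric])
    finally show ?thesis .
  qed
  ultimately show ?thesis using nz by blast
qed

lemma hermitian_orthonormal_eigenvectors:
  fixes A :: "nat \<Rightarrow> nat \<Rightarrow> complex"
  assumes herm: "\<And>i j. i < n \<Longrightarrow> j < n \<Longrightarrow> A j i = cnj (A i j)"
    and "m \<le> n"
  shows "\<exists>u \<mu>. (\<forall>k<m. \<forall>i<n. (\<Sum>j<n. A i j * u k j) = of_real (\<mu> k) * u k i) \<and>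
           (\<forall>k<m. \<forall>l<m. (\<Sum>i<n. u k i * cnj (u l i)) = (if k = l then 1 else 0))"
  using \<open>m \<le> n\<close>
proof (induction m)
  case 0
  then show ?case by simp
next
  case (Suc m)
  from Suc.IH[OF Suc_leD[OF Suc.prems]] obtain u \<mu> where
    u: "\<And>k i. k < m \<Longrightarrow> i < n \<Longrightarrow> (\<Sum>j<n. A i j * u k j) = complex_of_real (\<mu> k) * u k i"
       "\<And>k l. k < m \<Longrightarrow> l < m \<Longrightarrow> (\<Sum>i<n. u k i * cnj (u l i)) = (if k = l then 1 else 0)"
    by blast
  have "m < n" using Suc.prems by simp
  from eigenvector_orthogonal_to_eigenvectors[of n A m u \<mu>, OF herm this u(1)] obtain z \<nu> where
    z: "\<exists>i<n. z i \<noteq> 0" "\<And>i. i < n \<Longrightarrow> (\<Sum>j<n. A i j * z j) = \<nu> * z i"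
      "\<And>k. k < m \<Longrightarrow> (\<Sum>i<n. z i * cnj (u k i)) = 0"
    by blast
  define s where "s = (\<Sum>i<n. (cmod (z i))\<^sup>2)"
  obtain i0 where "i0 < n" "z i0 \<noteq> 0" using z(1) by blast
  then have "s > 0" unfolding s_def by (intro sum_pos2[of _ i0]) auto
  have zz: "(\<Sum>i<n. z i * cnj (z i)) = of_real s"
    unfolding s_def of_real_sum by (simp only: complex_norm_square)
  \<comment> \<open>Moving \<open>A\<close> to the other side of the inner product shows that the
    eigenvalue is real.\<close>
  have "\<nu> * of_real s = (\<Sum>i<n. (\<Sum>j<n. A i j * z j) * cnj (z i))"
    using z(2) by (simp add: zz[symmetric] sum_distrib_left mult.assoc)
  also have "\<dots> = (\<Sum>i<n. \<Sum>j<n. A i j * z j * cnj (z i))" by (simp add: sum_distrib_right)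
  also have "\<dots> = (\<Sum>j<n. \<Sum>i<n. A i j * z j * cnj (z i))" by (rule sum.swap)
  also have "\<dots> = (\<Sum>j<n. z j * cnj (\<Sum>i<n. A j i * z i))"
    unfolding cnj_sum sum_distrib_left
  proof (intro sum.cong[OF refl])
    fix j i assume "i \<in> {..<n}" "j \<in> {..<n}"
    then have "A i j = cnj (A j i)" by (intro herm) auto
    then show "A i j * z j * cnj (z i) = z j * cnj (A j i * z i)" by simp
  qed
  also have "\<dots> = cnj \<nu> * of_real s"
    using z(2) by (simp add: zz[symmetric] sum_distrib_left algebra_simps)
  finally have "cnj \<nu> = \<nu>" using \<open>s > 0\<close> by simp
  then have \<nu>: "\<nu> = of_real (Re \<nu>)" by (simp add: complex_eq_iff)
  define w where "w = (\<lambda>i. z i / of_real (sqrt s))"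
  have ww: "(\<Sum>i<n. w i * cnj (w i)) = 1"
  proof -
    have "(\<Sum>i<n. w i * cnj (w i)) = (\<Sum>i<n. z i * cnj (z i)) / (of_real (sqrt s) * of_real (sqrt s))"
      by (simp add: w_def sum_divide_distrib)
    also have "\<dots> = 1" using \<open>s > 0\<close> unfolding zz by (simp flip: of_real_mult)
    finally show ?thesis .
  qed
  have wu: "(\<Sum>i<n. w i * cnj (u k i)) = 0" if "k < m" for k
    using z(3)[OF that] by (simp add: w_def sum_divide_distrib[symmetric])
  have uw: "(\<Sum>i<n. u k i * cnj (w i)) = 0" if "k < m" for k
    using arg_cong[OF wu[OF that], of cnj] by (simp add: cnj_sum mult.commute)
  have Aw: "(\<Sum>j<n. A i j * w j) = of_real (Re \<nu>) * w i" if "i < n" for i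
    using z(2)[OF that] \<nu> by (simp add: w_def sum_divide_distrib[symmetric])
  show ?case
  proof (intro exI[of _ "u(m := w)"] exI[of _ "\<mu>(m := Re \<nu>)"] conjI allI impI)
    fix k i assume "k < Suc m" "i < n"
    then show "(\<Sum>j<n. A i j * (u(m := w)) k j) = of_real ((\<mu>(m := Re \<nu>)) k) * (u(m := w)) k i"
      using u(1) Aw by (cases "k = m") auto
  next
    fix k l assume "k < Suc m" "l < Suc m"
    then show "(\<Sum>i<n. (u(m := w)) k i * cnj ((u(m := w)) l i)) = (if k = l then 1 else 0)"
      using u(2) ww wu uw by (cases "k = m"; cases "l = m") auto
  qed
qed

lemma order_prod_linear:
  fixes c :: "nat \<Rightarrow> 'a::field"
  shows "order a (\<Prod>k\<leftarrow>[0..<n]. [:- c k, 1:]) = card {k. k < n \<and> c k = a}"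
proof (induction n)
  case 0
  show ?case by simp
next
  case (Suc n)
  have "(\<Prod>k\<leftarrow>[0..<n]. [:- c k, 1:]) \<noteq> 0" by (simp add: prod_list_zero_iff image_iff)
  then have "(\<Prod>k\<leftarrow>[0..<n]. [:- c k, 1:]) * [:- c n, 1:] \<noteq> 0"
    by (metis mult_eq_0_iff pCons_eq_0_iff zero_neq_one)
  from order_mult[OF this] have "order a (\<Prod>k\<leftarrow>[0..<Suc n]. [:- c k, 1:]) =
      card {k. k < n \<and> c k = a} + (if c n = a then 1 else 0)"
    using Suc by (simp add: order_linear')
  also have "{k. k < Suc n \<and> c k = a} =
      (if c n = a then insert n {k. k < n \<and> c k = a} else {k. k < n \<and> c k = a})"
    by (auto simp: less_Suc_eq)
  then have "card {k. k < n \<and> c k = a} + (if c n = a then 1 else 0) = card {k. k < Suc n \<and> c k = a}"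
    by simp
  finally show ?case .
qed

text \<open>Bridge from the definition of \<open>sq_neg\<close> to quadratic forms: the same
  eigenbasis diagonalises the form and turns the sum of multiplicities into a count of indices. The
  form has its conjugate on the second factor, so the coordinate of \<open>c\<close> along
  \<open>u k\<close> carries no conjugate.\<close>

lemma hermitian_form_diagonal:
  fixes A :: "nat \<Rightarrow> nat \<Rightarrow> complex"
  assumes herm: "\<forall>i<n. \<forall>j<n. A j i = cnj (A i j)"
  shows "\<exists>u \<mu>. (\<forall>k<n. \<forall>l<n. (\<Sum>i<n. u k i * cnj (u l i)) = (if k = l then 1 else 0)) \<and>
    (\<forall>c. (\<Sum>i<n. \<Sum>j<n. c i * cnj (c j) * A i j) =
        of_real (\<Sum>k<n. \<mu> k * (cmod (\<Sum>i<n. c i * u k i))\<^sup>2)) \<and>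
    sq_neg (mat n n (\<lambda>(i, j). A i j)) = card {k. k < n \<and> \<mu> k < (0::real)}"
proof -
  from hermitian_orthonormal_eigenvectors[of n A n, OF herm[rule_format] order_refl] obtain u \<mu> where
    eig: "\<And>k i. k < n \<Longrightarrow> i < n \<Longrightarrow> (\<Sum>j<n. A i j * u k j) = complex_of_real (\<mu> k) * u k i" and
    on: "\<And>k l. k < n \<Longrightarrow> l < n \<Longrightarrow> (\<Sum>i<n. u k i * cnj (u l i)) = (if k = l then 1 else 0)"
    by blast
  define M where "M = mat n n (\<lambda>(i, j). A i j)"
  define U where "U = mat n n (\<lambda>(i, k). u k i)"
  define V where "V = mat n n (\<lambda>(k, i). cnj (u k i))"
  define D where "D = mat n n (\<lambda>(i, j). if i = j then complex_of_real (\<mu> i) else 0)"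
  note carr = M_def U_def V_def D_def
  have carrier: "M \<in> carrier_mat n n" "U \<in> carrier_mat n n" "V \<in> carrier_mat n n" "D \<in> carrier_mat n n"
    by (auto simp: carr)
  have VU: "V * U = 1\<^sub>m n"
    by (rule eq_matI) (auto simp: U_def V_def scalar_prod_def lessThan_atLeast0[symmetric] mult.commute on)
  then have UV: "U * V = 1\<^sub>m n" using carrier mat_mult_left_right_inverse by blast
  have MU: "M * U = U * D"
  proof (rule eq_matI)
    fix i k assume "i < dim_row (U * D)" "k < dim_col (U * D)"
    then have ik: "i < n" "k < n" by (auto simp: carr)
    have "(M * U) $$ (i, k) = (\<Sum>j<n. A i j * u k j)"
      using ik by (simp add: M_def U_def scalar_prod_def lessThan_atLeast0[symmetric])
    moreover have "(U * D) $$ (i, k) = (\<Sum>l<n. u l i * (if l = k then complex_of_real (\<mu> l) else 0))"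
      using ik by (simp add: U_def D_def scalar_prod_def lessThan_atLeast0[symmetric])
    ultimately show "(M * U) $$ (i, k) = (U * D) $$ (i, k)" using ik eig by (simp add: if_distrib cong: if_cong)
  qed (auto simp: carr)
  have MUDV: "M = U * D * V"
    using carrier UV MU by (metis assoc_mult_mat right_mult_one_mat)
  then have "similar_mat_wit M D U V"
    using carrier UV VU by (intro similar_mat_witI[of _ _ n]) auto
  then have "char_poly M = char_poly D" by (intro char_poly_similar) (auto simp: similar_mat_def)
  also have "\<dots> = (\<Prod>a\<leftarrow>diag_mat D. [:- a, 1:])"
    by (rule char_poly_upper_triangular[OF carrier(4)]) (auto simp: D_def)
  also have "diag_mat D = map (\<lambda>k. complex_of_real (\<mu> k)) [0..<n]"
    by (auto simp: diag_mat_def D_def)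
  finally have cp: "char_poly M = (\<Prod>k\<leftarrow>[0..<n]. [:- complex_of_real (\<mu> k), 1:])"
    by (simp add: o_def)
  have ord: "order a (char_poly M) = card {k. k < n \<and> complex_of_real (\<mu> k) = a}" for a
    unfolding cp by (rule order_prod_linear)
  have ev: "eigenvalue M a \<longleftrightarrow> (\<exists>k<n. complex_of_real (\<mu> k) = a)" for a
    unfolding eigenvalue_root_char_poly[OF carrier(1)] cp
    by (auto simp: poly_prod_list prod_list_zero_iff)
  define N where "N = {k. k < n \<and> \<mu> k < 0}"
  have set: "{a. eigenvalue M a \<and> a \<in> \<real> \<and> Re a < 0} = (\<lambda>k. complex_of_real (\<mu> k)) ` N"
    unfolding ev N_def by auto
  \<comment> \<open>Indices are grouped by eigenvalue; each fibre has the size of the algebraic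
    multiplicity.\<close>
  have "sq_neg M = (\<Sum>a\<in>(\<lambda>k. complex_of_real (\<mu> k)) ` N. card {k\<in>N. complex_of_real (\<mu> k) = a})"
    unfolding sq_neg_def set ord by (intro sum.cong arg_cong[where f = card]) (auto simp: N_def)
  also have "\<dots> = card N"
    using sum.image_gen[of N "\<lambda>_. 1::nat" "\<lambda>k. complex_of_real (\<mu> k)"] by (simp add: N_def)
  finally have sq: "sq_neg M = card N" .
  have Aij: "A i j = (\<Sum>k<n. of_real (\<mu> k) * u k i * cnj (u k j))" if "i < n" "j < n" for i j
  proof -
    have "A i j = M $$ (i, j)" using that by (simp add: M_def)
    also have "\<dots> = (M * U * V) $$ (i, j)" using MUDV MU by simp
    also have "\<dots> = (\<Sum>k<n. (M * U) $$ (i, k) * cnj (u k j))"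
      using that carrier(1,2) by (simp add: V_def scalar_prod_def lessThan_atLeast0[symmetric])
    also have "\<dots> = (\<Sum>k<n. of_real (\<mu> k) * u k i * cnj (u k j))"
    proof (intro sum.cong refl)
      fix k assume "k \<in> {..<n}"
      then have "(M * U) $$ (i, k) = (\<Sum>j<n. A i j * u k j)"
        using that by (simp add: M_def U_def scalar_prod_def lessThan_atLeast0[symmetric])
      then show "(M * U) $$ (i, k) * cnj (u k j) = of_real (\<mu> k) * u k i * cnj (u k j)"
        using that \<open>k \<in> {..<n}\<close> eig by simp
    qed
    finally show ?thesis .
  qed
  have form: "(\<Sum>i<n. \<Sum>j<n. c i * cnj (c j) * A i j) =
        of_real (\<Sum>k<n. \<mu> k * (cmod (\<Sum>i<n. c i * u k i))\<^sup>2)" for c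
  proof -
    have "(\<Sum>i<n. \<Sum>j<n. c i * cnj (c j) * A i j) =
        (\<Sum>i<n. \<Sum>j<n. \<Sum>k<n. of_real (\<mu> k) * (c i * u k i) * cnj (c j * u k j))"
      by (intro sum.cong refl) (simp add: Aij sum_distrib_left algebra_simps)
    also have "\<dots> = (\<Sum>i<n. \<Sum>k<n. \<Sum>j<n. of_real (\<mu> k) * (c i * u k i) * cnj (c j * u k j))"
      by (intro sum.cong refl sum.swap)
    also have "\<dots> = (\<Sum>k<n. \<Sum>i<n. \<Sum>j<n. of_real (\<mu> k) * (c i * u k i) * cnj (c j * u k j))"
      by (rule sum.swap)
    also have "\<dots> = (\<Sum>k<n. of_real (\<mu> k) * ((\<Sum>i<n. c i * u k i) * cnj (\<Sum>i<n. c i * u k i)))"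
      unfolding cnj_sum sum_product unfolding sum_distrib_left by (simp add: mult.assoc)
    also have "\<dots> = of_real (\<Sum>k<n. \<mu> k * (cmod (\<Sum>i<n. c i * u k i))\<^sup>2)"
      unfolding of_real_sum of_real_mult complex_norm_square by simp
    finally show ?thesis .
  qed
  show ?thesis
    using on form sq unfolding M_def N_def by (intro exI[of _ u] exI[of _ \<mu>]) simp
qed

text \<open>One half of the min-max principle: if more than \<open>card M\<close> eigenvalues were
  negative, the span of their eigenvectors would contain a nonzero vector satisfying all
  constraints, and the form is negative there.\<close>

lemma sq_neg_le_codimension:
  fixes A :: "nat \<Rightarrow> nat \<Rightarrow> complex" and \<phi> :: "'m \<Rightarrow> nat \<Rightarrow> complex"
  assumes herm: "\<forall>i<n. \<forall>j<n. A j i = cnj (A i j)"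
    and "finite M"
    and nonneg: "\<And>c. (\<And>m. m \<in> M \<Longrightarrow> (\<Sum>i<n. \<phi> m i * c i) = 0) \<Longrightarrow>
           0 \<le> Re (\<Sum>i<n. \<Sum>j<n. c i * cnj (c j) * A i j)"
  shows "sq_neg (mat n n (\<lambda>(i, j). A i j)) \<le> card M"
proof -
  from hermitian_form_diagonal[of n A, OF herm] obtain u \<mu> where
    on: "\<forall>k<n. \<forall>l<n. (\<Sum>i<n. u k i * cnj (u l i)) = (if k = l then 1 else 0)"
    and form: "\<forall>c. (\<Sum>i<n. \<Sum>j<n. c i * cnj (c j) * A i j) =
        complex_of_real (\<Sum>k<n. \<mu> k * (cmod (\<Sum>i<n. c i * u k i))\<^sup>2)"
    and sq: "sq_neg (mat n n (\<lambda>(i, j). A i j)) = card {k. k < n \<and> \<mu> k < 0}"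
    by (elim exE conjE)
  define N where "N = {k. k < n \<and> \<mu> k < 0}"
  have finN: "finite N" by (simp add: N_def)
  show ?thesis
  proof (rule ccontr)
    assume "\<not> ?thesis"
    then have "card M < card N" using sq by (simp add: N_def)
    from homogeneous_system_nontrivial_solution[OF \<open>finite M\<close> finN this,
        of "\<lambda>m k. \<Sum>i<n. \<phi> m i * cnj (u k i)"] obtain t where
      t: "\<exists>k\<in>N. t k \<noteq> 0" "\<And>m. m \<in> M \<Longrightarrow> (\<Sum>k\<in>N. (\<Sum>i<n. \<phi> m i * cnj (u k i)) * t k) = 0" by blast
    \<comment> \<open>With the conjugates, the coordinate of \<open>c\<close> along
      \<open>u k\<close> in the sense of \<open>form\<close> is exactly \<open>t k\<close>.\<close>
    define c where "c = (\<lambda>i. \<Sum>k\<in>N. t k * cnj (u k i))"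
    have "0 \<le> Re (\<Sum>i<n. \<Sum>j<n. c i * cnj (c j) * A i j)"
    proof (rule nonneg)
      fix m assume "m \<in> M"
      have "(\<Sum>i<n. \<phi> m i * c i) = (\<Sum>i<n. \<Sum>k\<in>N. \<phi> m i * cnj (u k i) * t k)"
        unfolding c_def sum_distrib_left by (simp add: mult_ac)
      also have "\<dots> = (\<Sum>k\<in>N. \<Sum>i<n. \<phi> m i * cnj (u k i) * t k)" by (rule sum.swap)
      also have "\<dots> = 0" using t(2)[OF \<open>m \<in> M\<close>] by (simp add: sum_distrib_right)
      finally show "(\<Sum>i<n. \<phi> m i * c i) = 0" .
    qed
    also have "\<dots> = (\<Sum>k<n. \<mu> k * (cmod (\<Sum>i<n. c i * u k i))\<^sup>2)" unfolding form[rule_format] by simp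
    also have "\<dots> = (\<Sum>k<n. if k \<in> N then \<mu> k * (cmod (t k))\<^sup>2 else 0)"
    proof (intro sum.cong refl)
      fix k assume k: "k \<in> {..<n}"
      have "(\<Sum>i<n. c i * u k i) = (\<Sum>i<n. \<Sum>l\<in>N. t l * (u k i * cnj (u l i)))"
        unfolding c_def sum_distrib_right by (simp add: mult_ac)
      also have "\<dots> = (\<Sum>l\<in>N. \<Sum>i<n. t l * (u k i * cnj (u l i)))" by (rule sum.swap)
      also have "\<dots> = (\<Sum>l\<in>N. t l * (if k = l then 1 else 0))"
        using k by (intro sum.cong refl) (auto simp: sum_distrib_left[symmetric] on N_def)
      also have "\<dots> = (if k \<in> N then t k else 0)" using finN by (simp add: if_distrib cong: if_cong)
      finally show "\<mu> k * (cmod (\<Sum>i<n. c i * u k i))\<^sup>2 = (if k \<in> N then \<mu> k * (cmod (t k))\<^sup>2 else 0)"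
        by simp
    qed
    also have "\<dots> = (\<Sum>k\<in>N. \<mu> k * (cmod (t k))\<^sup>2)"
      by (subst sum.inter_restrict[symmetric]) (auto simp: N_def intro!: sum.cong)
    finally have "0 \<le> (\<Sum>k\<in>N. \<mu> k * (cmod (t k))\<^sup>2)" .
    moreover obtain k0 where k0: "k0 \<in> N" "t k0 \<noteq> 0" using t(1) by blast
    have "0 < (\<Sum>k\<in>N. - (\<mu> k * (cmod (t k))\<^sup>2))"
    proof (rule sum_pos2[OF finN k0(1)])
      show "0 < - (\<mu> k0 * (cmod (t k0))\<^sup>2)" using k0 by (simp add: N_def mult_neg_pos)
      show "\<And>k. k \<in> N \<Longrightarrow> 0 \<le> - (\<mu> k * (cmod (t k))\<^sup>2)" by (simp add: N_def mult_nonpos_nonneg)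
    qed
    ultimately show False by (simp add: sum_negf)
  qed
qed

text \<open>The other half: with fewer than \<open>card I\<close> negative eigenvalues, some
  nontrivial combination of the \<open>X\<close> has zero coordinate along every negative
  eigenvector, and the form is nonnegative on it. Linear independence of the family is contained in
  \<open>neg\<close>, as the zero vector gives the value 0.\<close>

lemma sq_neg_ge_dimension:
  fixes A :: "nat \<Rightarrow> nat \<Rightarrow> complex" and X :: "'i \<Rightarrow> nat \<Rightarrow> complex"
  assumes herm: "\<forall>i<n. \<forall>j<n. A j i = cnj (A i j)"
    and "finite I"
    and neg: "\<And>x c. \<exists>\<iota>\<in>I. x \<iota> \<noteq> 0 \<Longrightarrow> c = (\<lambda>i. \<Sum>\<iota>\<in>I. x \<iota> * X \<iota> i) \<Longrightarrow>
           Re (\<Sum>i<n. \<Sum>j<n. c i * cnj (c j) * A i j) < 0"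
  shows "card I \<le> sq_neg (mat n n (\<lambda>(i, j). A i j))"
proof -
  from hermitian_form_diagonal[of n A, OF herm] obtain u \<mu> where
    on: "\<forall>k<n. \<forall>l<n. (\<Sum>i<n. u k i * cnj (u l i)) = (if k = l then 1 else 0)"
    and form: "\<forall>c. (\<Sum>i<n. \<Sum>j<n. c i * cnj (c j) * A i j) =
        complex_of_real (\<Sum>k<n. \<mu> k * (cmod (\<Sum>i<n. c i * u k i))\<^sup>2)"
    and sq: "sq_neg (mat n n (\<lambda>(i, j). A i j)) = card {k. k < n \<and> \<mu> k < 0}"
    by (elim exE conjE)
  define N where "N = {k. k < n \<and> \<mu> k < 0}"
  have finN: "finite N" by (simp add: N_def)
  show ?thesis
  proof (rule ccontr)
    assume "\<not> ?thesis"
    then have "card N < card I" using sq by (simp add: N_def)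
    from homogeneous_system_nontrivial_solution[OF finN \<open>finite I\<close> this,
        of "\<lambda>k \<iota>. \<Sum>i<n. X \<iota> i * u k i"] obtain x where
      x: "\<exists>\<iota>\<in>I. x \<iota> \<noteq> 0" "\<And>k. k \<in> N \<Longrightarrow> (\<Sum>\<iota>\<in>I. (\<Sum>i<n. X \<iota> i * u k i) * x \<iota>) = 0" by blast
    define c where "c = (\<lambda>i. \<Sum>\<iota>\<in>I. x \<iota> * X \<iota> i)"
    have "(\<Sum>i<n. c i * u k i) = 0" if "k \<in> N" for k
    proof -
      have "(\<Sum>i<n. c i * u k i) = (\<Sum>i<n. \<Sum>\<iota>\<in>I. X \<iota> i * u k i * x \<iota>)"
        unfolding c_def sum_distrib_right by (simp add: mult_ac)
      also have "\<dots> = (\<Sum>\<iota>\<in>I. \<Sum>i<n. X \<iota> i * u k i * x \<iota>)" by (rule sum.swap)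
      also have "\<dots> = 0" using x(2)[OF that] by (simp add: sum_distrib_right)
      finally show ?thesis .
    qed
    then have "0 \<le> (\<Sum>k<n. \<mu> k * (cmod (\<Sum>i<n. c i * u k i))\<^sup>2)"
      by (intro sum_nonneg) (metis (mono_tags, lifting) N_def lessThan_iff linorder_not_le mem_Collect_eq
          mult_nonneg_nonneg norm_zero zero_eq_power2 mult_zero_right order_refl zero_le_power2)
    moreover have "Re (\<Sum>i<n. \<Sum>j<n. c i * cnj (c j) * A i j) < 0" by (rule neg[OF x(1) c_def])
    ultimately show False unfolding form[rule_format] by simp
  qed
qed

section \<open>Pick forms of Schur functions\<close>

lemma one_minus_mult_cnj_nonzero:
  assumes "cmod z \<le> 1" "cmod w < 1"
  shows "1 - cnj w * z \<noteq> 0" "1 - z * cnj w \<noteq> 0"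
proof -
  have "cmod (cnj w * z) < 1"
    using assms by (simp add: norm_mult) (metis mult_left_le norm_ge_zero order_le_less_trans)
  then show "1 - cnj w * z \<noteq> 0" by auto
  then show "1 - z * cnj w \<noteq> 0" by (simp add: mult.commute)
qed

text \<open>Cauchy's formula rewritten: on the unit circle \<open>cnj e = 1 / e\<close>, which turns
  the conjugated Szego kernel into the Cauchy kernel times the normalised derivative of the
  path.\<close>

lemma szego_reproducing:
  assumes F: "continuous_on (cball 0 1) F" "F holomorphic_on ball 0 1" and w: "cmod w < 1"
  shows "((\<lambda>t. F (circlepath 0 1 t) * cnj (1 / (1 - cnj w * circlepath 0 1 t))) has_integral F w) {0..1}"
proof -
  have "((\<lambda>u. F u / (u - w)) has_contour_integral 2 * complex_of_real pi * \<i> * F w) (circlepath 0 1)"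
    using Cauchy_integral_circlepath[OF F] w by simp
  then have "((\<lambda>t. F (circlepath 0 1 t) / (circlepath 0 1 t - w) *
      vector_derivative (circlepath 0 1) (at t within {0..1})) has_integral
      2 * complex_of_real pi * \<i> * F w) {0..1}" by (simp add: has_contour_integral_def)
  from has_integral_mult_left[OF this, of "1 / (2 * complex_of_real pi * \<i>)"]
  have "((\<lambda>t. F (circlepath 0 1 t) / (circlepath 0 1 t - w) *
      vector_derivative (circlepath 0 1) (at t within {0..1}) * (1 / (2 * complex_of_real pi * \<i>)))
      has_integral F w) {0..1}" by simp
  then show ?thesis
  proof (rule has_integral_eq[rotated])
    fix t :: real assume t: "t \<in> {0..1}"
    define e where "e = circlepath 0 1 t"
    have e: "e = exp (2 * of_real pi * \<i> * of_real t)"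
      by (simp add: e_def circlepath)
    have ne: "cmod e = 1" by (simp add: e)
    then have cnje: "cnj e = 1 / e"
      by (metis complex_div_cnj divide_eq_1_iff mult_1 norm_one of_real_1 one_power2 zero_neq_one div_by_1)
    have e0: "e \<noteq> 0" "e - w \<noteq> 0" using ne w by auto
    have vd: "vector_derivative (circlepath 0 1) (at t within {0..1}) = 2 * of_real pi * \<i> * e"
      using t by (simp add: vector_derivative_circlepath01 e)
    have "cnj (1 / (1 - cnj w * e)) = e / (e - w)"
      using e0 by (simp add: cnje divide_simps)
    then show "F (circlepath 0 1 t) / (circlepath 0 1 t - w) *
        vector_derivative (circlepath 0 1) (at t within {0..1}) * (1 / (2 * complex_of_real pi * \<i>)) =
        F (circlepath 0 1 t) * cnj (1 / (1 - cnj w * circlepath 0 1 t))"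
      unfolding vd e_def[symmetric] by simp
  qed
qed

text \<open>With \<open>h\<close>, \<open>g\<close> the combinations of Szego kernels with coefficients \<open>cnj (c x)\<close> and
  \<open>cnj (c x * S x)\<close>, the reproducing property turns the Pick form into the mean over the circle
  of \<open>|h|^2 - 2 Re (S g cnj h) + |g|^2\<close>, which is nonnegative because \<open>|S| \<le> 1\<close>.\<close>
lemma pick_form_nonneg_closed_disc:
  assumes S: "continuous_on (cball 0 1) S" "S holomorphic_on ball 0 1" "\<And>z. cmod z \<le> 1 \<Longrightarrow> cmod (S z) \<le> 1"
    and X: "finite X" "\<And>x. x \<in> X \<Longrightarrow> cmod x < 1"
  shows "0 \<le> Re (\<Sum>x\<in>X. \<Sum>y\<in>X. c x * cnj (c y) * ((1 - S x * cnj (S y)) / (1 - x * cnj y)))"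
proof -
  define k where "k = (\<lambda>d z. \<Sum>x\<in>X. cnj (d x) / (1 - cnj x * z))"
  have kcont: "continuous_on (cball 0 1) (k d)" for d
    unfolding k_def using one_minus_mult_cnj_nonzero X by (intro continuous_intros) auto
  have khol: "k d holomorphic_on ball 0 1" for d
    unfolding k_def using one_minus_mult_cnj_nonzero(1)[OF less_imp_le] X by (intro holomorphic_intros) auto
  have inner: "((\<lambda>t. F (circlepath 0 1 t) * cnj (k d (circlepath 0 1 t))) has_integral (\<Sum>x\<in>X. d x * F x)) {0..1}"
    if "continuous_on (cball 0 1) F" "F holomorphic_on ball 0 1" for F d
  proof -
    have "((\<lambda>t. \<Sum>x\<in>X. d x * (F (circlepath 0 1 t) * cnj (1 / (1 - cnj x * circlepath 0 1 t))))
        has_integral (\<Sum>x\<in>X. d x * F x)) {0..1}"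
      using X szego_reproducing[OF that] by (intro has_integral_sum has_integral_mult_right) auto
    then show ?thesis
      unfolding k_def cnj_sum sum_distrib_left by (simp add: mult_ac)
  qed
  define h where "h = k c"
  define g where "g = k (\<lambda>x. c x * S x)"
  define a where "a = (\<Sum>x\<in>X. c x * h x)"
  define b where "b = (\<Sum>x\<in>X. c x * S x * g x)"
  have Ia: "((\<lambda>t. h (circlepath 0 1 t) * cnj (h (circlepath 0 1 t))) has_integral a) {0..1}"
    using inner[of h c] kcont khol unfolding h_def a_def by simp
  have "((\<lambda>t. (\<lambda>z. S z * g z) (circlepath 0 1 t) * cnj (h (circlepath 0 1 t))) has_integral
      (\<Sum>x\<in>X. c x * (\<lambda>z. S z * g z) x)) {0..1}"
    unfolding h_def g_def using S kcont khol
    by (intro inner continuous_on_mult holomorphic_on_mult) auto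
  then have Ib1: "((\<lambda>t. S (circlepath 0 1 t) * g (circlepath 0 1 t) * cnj (h (circlepath 0 1 t))) has_integral b) {0..1}"
    by (simp add: b_def mult.assoc)
  have Ib2: "((\<lambda>t. g (circlepath 0 1 t) * cnj (g (circlepath 0 1 t))) has_integral b) {0..1}"
    using inner[of g "\<lambda>x. c x * S x"] kcont khol unfolding g_def b_def by simp
  have form: "a - b = (\<Sum>x\<in>X. \<Sum>y\<in>X. c x * cnj (c y) * ((1 - S x * cnj (S y)) / (1 - x * cnj y)))"
    unfolding a_def b_def h_def g_def k_def sum_distrib_left sum_subtractf[symmetric]
    by (intro sum.cong refl) (simp add: diff_divide_distrib algebra_simps)
  \<comment> \<open>The form \<open>a - b\<close> is written \<open>a - 2 * b + b\<close> because
    \<open>b\<close> is a mean in two ways: of \<open>S * g * cnj h\<close> and of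
    \<open>g * cnj g\<close>.\<close>
  have "((\<lambda>t. Re (h (circlepath 0 1 t) * cnj (h (circlepath 0 1 t)) -
        2 * (S (circlepath 0 1 t) * g (circlepath 0 1 t) * cnj (h (circlepath 0 1 t))) +
        g (circlepath 0 1 t) * cnj (g (circlepath 0 1 t)))) has_integral Re (a - 2 * b + b)) {0..1}"
    by (intro has_integral_Re has_integral_add has_integral_diff Ia Ib2 has_integral_mult_right Ib1)
  then have "0 \<le> Re (a - 2 * b + b)"
  proof (rule has_integral_nonneg)
    fix t :: real assume "t \<in> {0..1}"
    define z where "z = circlepath 0 1 t"
    have "cmod z = 1" by (simp add: z_def circlepath)
    then have "cmod (S z) \<le> 1" using S(3) by simp
    have "Re (S z * g z * cnj (h z)) \<le> cmod (S z * g z * cnj (h z))" by (rule complex_Re_le_cmod)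
    also have "\<dots> \<le> 1 * cmod (g z) * cmod (h z)"
      unfolding norm_mult complex_mod_cnj using \<open>cmod (S z) \<le> 1\<close> by (intro mult_right_mono) auto
    finally have "Re (S z * g z * cnj (h z)) \<le> cmod (g z) * cmod (h z)" by simp
    moreover have "0 \<le> (cmod (g z) - cmod (h z))\<^sup>2" by simp
    moreover have "Re (h z * cnj (h z)) = (cmod (h z))\<^sup>2" "Re (g z * cnj (g z)) = (cmod (g z))\<^sup>2"
      by (simp_all add: complex_norm_square[symmetric] flip: of_real_power)
    ultimately show "0 \<le> Re (h (circlepath 0 1 t) * cnj (h (circlepath 0 1 t)) -
        2 * (S (circlepath 0 1 t) * g (circlepath 0 1 t) * cnj (h (circlepath 0 1 t))) +
        g (circlepath 0 1 t) * cnj (g (circlepath 0 1 t)))"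
      unfolding z_def[symmetric] by (simp add: power2_diff)
  qed
  then show ?thesis using form by simp
qed

text \<open>A Schur function need not extend continuously to the circle, but its dilations by
  factors below 1 do. The form involves finitely many values inside the disc, so nonnegativity
  passes to the limit as the factor tends to 1.\<close>

lemma schur_pick_form_nonneg:
  assumes S: "schur_function S" and X: "finite X" "X \<subseteq> disc"
  shows "0 \<le> Re (\<Sum>x\<in>X. \<Sum>y\<in>X. c x * cnj (c y) * ((1 - S x * cnj (S y)) / (1 - x * cnj y)))"
proof -
  define r where "r = (\<lambda>n. 1 - inverse (real (Suc n)))"
  have r: "0 \<le> r n" "r n < 1" for n by (auto simp: r_def field_simps)
  have rlim: "r \<longlonglongrightarrow> 1" unfolding r_def
    using tendsto_diff[OF tendsto_const LIMSEQ_inverse_real_of_nat, of 1] by simp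
  define T where "T = (\<lambda>n z. S (of_real (r n) * z))"
  have Xd: "cmod x < 1" if "x \<in> X" for x using X that by (auto simp: disc_def)
  have hol: "S holomorphic_on ball 0 1" and S1: "\<And>z. cmod z < 1 \<Longrightarrow> cmod (S z) \<le> 1"
    using S by (auto simp: schur_function_def disc_def)
  have rz: "cmod (of_real (r n) * z) < 1" if "cmod z \<le> 1" for n z
  proof -
    have "cmod (of_real (r n) * z) \<le> r n * 1"
      using r that by (simp add: norm_mult mult_left_le)
    then show ?thesis using r[of n] by simp
  qed
  have "0 \<le> Re (\<Sum>x\<in>X. \<Sum>y\<in>X. c x * cnj (c y) * ((1 - T n x * cnj (T n y)) / (1 - x * cnj y)))" for n
  proof (rule pick_form_nonneg_closed_disc)
    have "(S \<circ> (\<lambda>z. of_real (r n) * z)) holomorphic_on cball 0 1"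
      using rz by (intro holomorphic_on_compose_gen[OF _ hol] holomorphic_intros) auto
    then have T: "T n holomorphic_on cball 0 1" by (simp add: T_def o_def)
    then show "continuous_on (cball 0 1) (T n)" by (rule holomorphic_on_imp_continuous_on)
    show "T n holomorphic_on ball 0 1" using T by (rule holomorphic_on_subset) auto
    show "cmod (T n z) \<le> 1" if "cmod z \<le> 1" for z using S1 rz[OF that] by (simp add: T_def)
  qed (use X Xd in auto)
  moreover have "(\<lambda>n. Re (\<Sum>x\<in>X. \<Sum>y\<in>X. c x * cnj (c y) * ((1 - T n x * cnj (T n y)) / (1 - x * cnj y))))
      \<longlonglongrightarrow> Re (\<Sum>x\<in>X. \<Sum>y\<in>X. c x * cnj (c y) * ((1 - S x * cnj (S y)) / (1 - x * cnj y)))"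
  proof -
    have Tlim: "(\<lambda>n. T n x) \<longlonglongrightarrow> S x" if "x \<in> X" for x
    proof -
      have "isCont S x"
        using holomorphic_on_imp_continuous_on[OF hol] Xd[OF that]
        by (simp add: continuous_on_eq_continuous_at)
      moreover have "(\<lambda>n. of_real (r n) * x) \<longlonglongrightarrow> of_real 1 * x"
        by (intro tendsto_intros rlim)
      ultimately show ?thesis unfolding T_def by (intro isCont_tendsto_compose[of x S]) auto
    qed
    show ?thesis
      using Tlim Xd one_minus_mult_cnj_nonzero(2)[OF less_imp_le] by (intro tendsto_intros) auto
  qed
  ultimately show ?thesis by (intro LIMSEQ_le_const) auto
qed

section \<open>Blaschke products\<close>

text \<open>Needed because \<open>blaschke\<close> prescribes modulus 1 only where the denominator
  is nonzero. The circle has no isolated points, so equality of moduli of numerator and denominator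
  extends by continuity.\<close>

lemma sphere_eq_of_cofinite:
  fixes f g :: "complex \<Rightarrow> real"
  assumes "continuous_on UNIV f" "continuous_on UNIV g" "finite Z"
    and eq: "\<And>z. cmod z = 1 \<Longrightarrow> z \<notin> Z \<Longrightarrow> f z = g z" and z: "cmod z = 1"
  shows "f z = g z"
proof -
  have "z islimpt sphere 0 1"
  proof (rule connected_imp_perfect)
    show "connected (sphere (0::complex) 1)" by (rule connected_sphere) simp
    show "sphere 0 1 \<noteq> {x}" for x :: complex
    proof
      assume "sphere 0 1 = {x}"
      moreover have "1 \<in> sphere (0::complex) 1" "-1 \<in> sphere (0::complex) 1" by auto
      ultimately have "(1::complex) = -1" by (metis singletonD)
      then show False by simp
    qed
  qed (use z in auto)
  moreover have "sphere 0 1 \<subseteq> (sphere 0 1 - Z) \<union> Z" by auto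
  ultimately have "z islimpt (sphere 0 1 - Z) \<union> Z" by (rule islimpt_subset)
  then have "z islimpt (sphere 0 1 - Z)"
    using \<open>finite Z\<close> islimpt_Un islimpt_finite by blast
  moreover have "closed {w. f w = g w}" using assms(1,2) by (intro closed_Collect_eq) auto
  moreover have "sphere 0 1 - Z \<subseteq> {w. f w = g w}" using eq by auto
  ultimately have "z \<in> {w. f w = g w}" by (meson islimpt_subset closed_limpt)
  then show ?thesis by simp
qed

lemma norm_one_minus_cnj_mult:
  assumes "cmod z = 1"
  shows "cmod (1 - cnj a * z) = cmod (z - a)"
proof -
  have "z * cnj z = 1" using assms by (simp add: complex_norm_square[symmetric])
  then have "1 - cnj a * z = z * cnj (z - a)" by (simp add: algebra_simps)
  then show ?thesis using assms by (metis complex_mod_cnj mult_1 norm_mult)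
qed

text \<open>The maximum principle for \<open>h\<close> and for \<open>1 / h\<close> gives modulus 1
  throughout the disc, so the maximum is attained at an interior point.\<close>

lemma holomorphic_unimodular_on_circle_constant:
  assumes h: "h holomorphic_on cball 0 1" "\<And>z. cmod z \<le> 1 \<Longrightarrow> h z \<noteq> 0"
    and one: "\<And>z. cmod z = 1 \<Longrightarrow> cmod (h z) = 1"
  shows "\<exists>\<kappa>. cmod \<kappa> = 1 \<and> (\<forall>z. cmod z < 1 \<longrightarrow> h z = \<kappa>)"
proof -
  have cont: "continuous_on (cball 0 1) h" using h(1) by (rule holomorphic_on_imp_continuous_on)
  have hol: "h holomorphic_on ball 0 1" using h(1) by (rule holomorphic_on_subset) auto
  have one': "cmod (h z) = 1" if "cmod z < 1" for z
  proof (rule antisym)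
    show "cmod (h z) \<le> 1"
      using maximum_modulus_frontier[of h "ball 0 1" 1 z] hol cont one that by auto
    have "cmod (inverse (h z)) \<le> 1"
    proof (rule maximum_modulus_frontier[of "\<lambda>z. inverse (h z)" "ball 0 1" 1 z])
      show "(\<lambda>z. inverse (h z)) holomorphic_on interior (ball 0 1)"
        using hol h(2) by (intro holomorphic_intros) auto
      show "continuous_on (closure (ball 0 1)) (\<lambda>z. inverse (h z))"
        using cont h(2) by (intro continuous_intros) auto
    qed (use one that in \<open>auto simp: norm_inverse\<close>)
    then show "1 \<le> cmod (h z)" using h(2)[of z] that
      by (simp add: norm_inverse inverse_le_1_iff)
  qed
  then have "h constant_on ball 0 1"
    by (intro maximum_modulus_principle[where U = "ball 0 1" and \<xi> = 0] hol) auto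
  then obtain \<kappa> where \<kappa>: "\<And>z. z \<in> ball 0 1 \<Longrightarrow> h z = \<kappa>" unfolding constant_on_def by blast
  have "cmod \<kappa> = 1" using one'[of 0] \<kappa>[of 0] by simp
  then show ?thesis using \<kappa> by (intro exI[of _ \<kappa>]) simp
qed

text \<open>Dividing \<open>B\<close> by the Blaschke factors of its zeros in the disc leaves
  \<open>h\<close>, which is holomorphic and zero-free on the closed disc and unimodular on the
  circle, hence constant.\<close>

lemma blaschke_factorization:
  assumes "blaschke B"
  obtains \<kappa> r where "finite (zero_set B)" "cmod \<kappa> = 1"
    "\<And>a. a \<in> zero_set B \<Longrightarrow> r a > 0"
    "\<And>z. z \<in> disc \<Longrightarrow> B z = \<kappa> * (\<Prod>a\<in>zero_set B. ((z - a) / (1 - cnj a * z)) ^ r a)"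
proof -
  from assms obtain p q where pq: "coprime p q" "\<And>z. z \<in> disc \<Longrightarrow> poly q z \<noteq> 0"
    "\<And>z. cmod z = 1 \<Longrightarrow> poly q z \<noteq> 0 \<Longrightarrow> cmod (poly p z / poly q z) = 1"
    "\<And>z. z \<in> disc \<Longrightarrow> B z = poly p z / poly q z"
    unfolding blaschke_def by blast
  have "q \<noteq> 0" using pq(2)[of 0] by (auto simp: disc_def)
  have pqn: "cmod (poly p z) = cmod (poly q z)" if "cmod z = 1" for z
  proof (rule sphere_eq_of_cofinite[where Z = "{z. poly q z = 0}" and z = z])
    show "finite {z. poly q z = 0}" using \<open>q \<noteq> 0\<close> by (rule poly_roots_finite)
    show "cmod (poly p z) = cmod (poly q z)" if "cmod z = 1" "z \<notin> {z. poly q z = 0}" for z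
      using pq(3)[of z] that by (simp add: norm_divide)
  qed (auto intro!: continuous_intros simp: that)
  \<comment> \<open>The moduli agree on the circle, so a zero of either polynomial there would be a
    common zero, against coprimality.\<close>
  have nz1: "poly p z \<noteq> 0" "poly q z \<noteq> 0" if "cmod z = 1" for z
    using coprime_poly_0[OF pq(1), of z] pqn[OF that] by auto
  have "p \<noteq> 0" using nz1(1)[of 1] by auto
  define A where "A = zero_set B"
  define R where "R = {z. poly p z = 0} - A"
  have AR: "{z. poly p z = 0} = A \<union> R" and A: "A = {z. poly p z = 0} \<inter> disc"
    using pq(2,4) by (auto simp: A_def R_def zero_set_def)
  have fin: "finite A" "finite R" using poly_roots_finite[OF \<open>p \<noteq> 0\<close>] by (simp_all add: A R_def)
  define r where "r = (\<lambda>a. order a p)"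
  \<comment> \<open>The part of \<open>p\<close> whose roots lie outside the open disc; by
    \<open>nz1\<close> none of them is on the circle.\<close>
  define P2 where "P2 = Polynomial.smult (lead_coeff p) (\<Prod>a\<in>R. [:- a, 1:] ^ r a)"
  have "p = Polynomial.smult (lead_coeff p) (\<Prod>a\<in>A \<union> R. [:- a, 1:] ^ r a)"
    unfolding AR[symmetric] r_def by (rule complex_poly_decompose[symmetric])
  also have "(\<Prod>a\<in>A \<union> R. [:- a, 1:] ^ r a) = (\<Prod>a\<in>A. [:- a, 1:] ^ r a) * (\<Prod>a\<in>R. [:- a, 1:] ^ r a)"
    using fin by (intro prod.union_disjoint) (auto simp: R_def)
  finally have p: "p = (\<Prod>a\<in>A. [:- a, 1:] ^ r a) * P2" by (simp add: P2_def mult.commute)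
  have pz: "poly p z = (\<Prod>a\<in>A. (z - a) ^ r a) * poly P2 z" for z
    by (subst p) (simp add: poly_prod)
  have P2nz: "poly P2 z \<noteq> 0" if "cmod z \<le> 1" for z
  proof (cases "cmod z = 1")
    case True
    then show ?thesis using nz1(1)[of z] pz by auto
  next
    case False
    with that have "z \<notin> R" by (auto simp: R_def A disc_def)
    then show ?thesis using \<open>p \<noteq> 0\<close> fin by (auto simp: P2_def poly_prod)
  qed
  have qnz: "poly q z \<noteq> 0" if "cmod z \<le> 1" for z
    using that pq(2)[of z] nz1(2)[of z] by (cases "cmod z = 1") (auto simp: disc_def)
  have Ad: "cmod a < 1" if "a \<in> A" for a using that by (auto simp: A disc_def)
  define C where "C = (\<lambda>z. \<Prod>a\<in>A. (1 - cnj a * z) ^ r a)"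
  have Cnz: "C z \<noteq> 0" if "cmod z \<le> 1" for z
    using fin Ad one_minus_mult_cnj_nonzero(1)[OF that] by (auto simp: C_def)
  define h where "h = (\<lambda>z. poly P2 z * C z / poly q z)"
  have "\<exists>\<kappa>. cmod \<kappa> = 1 \<and> (\<forall>z. cmod z < 1 \<longrightarrow> h z = \<kappa>)"
  proof (rule holomorphic_unimodular_on_circle_constant)
    show "h holomorphic_on cball 0 1"
      unfolding h_def C_def using qnz by (intro holomorphic_intros) auto
    show "h z \<noteq> 0" if "cmod z \<le> 1" for z using P2nz Cnz qnz that by (simp add: h_def)
    show "cmod (h z) = 1" if "cmod z = 1" for z
    proof -
      have "cmod (C z) = cmod (\<Prod>a\<in>A. (z - a) ^ r a)"
        by (simp add: C_def prod_norm[symmetric] norm_power norm_one_minus_cnj_mult[OF that])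
      then have "cmod (h z) = cmod (poly p z) / cmod (poly q z)"
        by (simp add: h_def norm_divide norm_mult pz mult.commute)
      then show ?thesis using pqn[OF that] nz1(2)[OF that] by simp
    qed
  qed
  then obtain \<kappa> where \<kappa>: "cmod \<kappa> = 1" "\<And>z. cmod z < 1 \<Longrightarrow> h z = \<kappa>" by blast
  show ?thesis
  proof (rule that[of \<kappa> r])
    show "finite (zero_set B)" using fin by (simp add: A_def)
    show "r a > 0" if "a \<in> zero_set B" for a
      using that A \<open>p \<noteq> 0\<close> by (simp add: A_def[symmetric] r_def order_root)
    show "B z = \<kappa> * (\<Prod>a\<in>zero_set B. ((z - a) / (1 - cnj a * z)) ^ r a)" if "z \<in> disc" for z
    proof -
      have z: "cmod z < 1" using that by (simp add: disc_def)
      have "(\<Prod>a\<in>A. ((z - a) / (1 - cnj a * z)) ^ r a) = (\<Prod>a\<in>A. (z - a) ^ r a) / C z"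
        by (simp add: C_def power_divide prod_dividef)
      then have "\<kappa> * (\<Prod>a\<in>A. ((z - a) / (1 - cnj a * z)) ^ r a) = h z * ((\<Prod>a\<in>A. (z - a) ^ r a) / C z)"
        using \<kappa>(2)[OF z] by simp
      also have "\<dots> = poly p z / poly q z" using Cnz[of z] z by (simp add: h_def pz)
      finally have "\<kappa> * (\<Prod>a\<in>A. ((z - a) / (1 - cnj a * z)) ^ r a) = poly p z / poly q z" .
      then show ?thesis using pq(4)[OF that] by (simp add: A_def)
    qed
  qed (rule \<kappa>)
qed

text \<open>The Pick kernel of \<open>B\<close> is a sum of \<open>q\<close> rank-one squares. The
  denominator is multiplied out to make products of functions easy to treat; the \<open>E k\<close>
  may be dependent, so \<open>q\<close> only bounds the rank from above.\<close>

definition kernel_rank_le :: "(complex \<Rightarrow> complex) \<Rightarrow> nat \<Rightarrow> bool" where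
  "kernel_rank_le B q \<longleftrightarrow> (\<exists>E. \<forall>z\<in>disc. \<forall>w\<in>disc.
     1 - B z * cnj (B w) = (1 - z * cnj w) * (\<Sum>k<q. E k z * cnj (E k w)))"

lemma kernel_rank_le_const: "cmod \<kappa> = 1 \<Longrightarrow> kernel_rank_le (\<lambda>_. \<kappa>) 0"
  by (simp add: kernel_rank_le_def complex_norm_square[symmetric])

text \<open>For a single Blaschke factor the only square is that of the normalised Szego kernel at
  \<open>a\<close>.\<close>

lemma kernel_rank_le_factor:
  assumes "cmod a < 1"
  shows "kernel_rank_le (\<lambda>z. (z - a) / (1 - cnj a * z)) 1"
  unfolding kernel_rank_le_def
proof (intro exI[of _ "\<lambda>_ z. of_real (sqrt (1 - (cmod a)\<^sup>2)) / (1 - cnj a * z)"] ballI)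
  fix z w assume "z \<in> disc" "w \<in> disc"
  then have nz: "1 - cnj a * z \<noteq> 0" "1 - a * cnj w \<noteq> 0"
    using one_minus_mult_cnj_nonzero[of z a] one_minus_mult_cnj_nonzero[of a w] assms
    by (auto simp: disc_def)
  have "(cmod a)\<^sup>2 \<le> 1" using assms by (simp add: power_le_one)
  then have s: "of_real (sqrt (1 - (cmod a)\<^sup>2)) * of_real (sqrt (1 - (cmod a)\<^sup>2)) = 1 - a * cnj a"
    by (simp add: complex_norm_square[symmetric] flip: of_real_mult)
  have "1 - (z - a) / (1 - cnj a * z) * cnj ((w - a) / (1 - cnj a * w)) =
      ((1 - cnj a * z) * (1 - a * cnj w) - (z - a) * cnj (w - a)) / ((1 - cnj a * z) * (1 - a * cnj w))"
    using nz by (simp add: divide_simps)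
  also have "(1 - cnj a * z) * (1 - a * cnj w) - (z - a) * cnj (w - a) = (1 - z * cnj w) * (1 - a * cnj a)"
    by (simp add: algebra_simps)
  finally show "1 - (z - a) / (1 - cnj a * z) * cnj ((w - a) / (1 - cnj a * w)) = (1 - z * cnj w) *
      (\<Sum>k<1::nat. of_real (sqrt (1 - (cmod a)\<^sup>2)) / (1 - cnj a * z) * cnj (of_real (sqrt (1 - (cmod a)\<^sup>2)) / (1 - cnj a * w)))"
    by (simp add: s)
qed

text \<open>The defect of a product is the defect of \<open>B1\<close> plus the defect of
  \<open>B2\<close> multiplied by \<open>B1 z * cnj (B1 w)\<close>. So the functions for
  \<open>B2\<close>, multiplied by \<open>B1\<close>, are appended to those for
  \<open>B1\<close>.\<close>

lemma kernel_rank_le_mult: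
  assumes "kernel_rank_le B1 q1" "kernel_rank_le B2 q2"
  shows "kernel_rank_le (\<lambda>z. B1 z * B2 z) (q1 + q2)"
proof -
  from assms obtain E1 E2 where
    E1: "\<And>z w. z \<in> disc \<Longrightarrow> w \<in> disc \<Longrightarrow> 1 - B1 z * cnj (B1 w) = (1 - z * cnj w) * (\<Sum>k<q1. E1 k z * cnj (E1 k w))" and
    E2: "\<And>z w. z \<in> disc \<Longrightarrow> w \<in> disc \<Longrightarrow> 1 - B2 z * cnj (B2 w) = (1 - z * cnj w) * (\<Sum>k<q2. E2 k z * cnj (E2 k w))"
    unfolding kernel_rank_le_def by blast
  define E where "E = (\<lambda>k z. if k < q1 then E1 k z else B1 z * E2 (k - q1) z)"
  have "1 - B1 z * B2 z * cnj (B1 w * B2 w) = (1 - z * cnj w) * (\<Sum>k<q1 + q2. E k z * cnj (E k w))"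
    if "z \<in> disc" "w \<in> disc" for z w
  proof -
    have "(\<Sum>k<q1 + q2. E k z * cnj (E k w)) =
        (\<Sum>k<q1. E k z * cnj (E k w)) + (\<Sum>k<q2. E (q1 + k) z * cnj (E (q1 + k) w))"
      by (induction q2) (simp_all add: add.assoc)
    also have "\<dots> = (\<Sum>k<q1. E1 k z * cnj (E1 k w)) + B1 z * cnj (B1 w) * (\<Sum>k<q2. E2 k z * cnj (E2 k w))"
      unfolding sum_distrib_left by (simp add: E_def mult_ac)
    also have "(1 - z * cnj w) * \<dots> = (1 - B1 z * cnj (B1 w)) + B1 z * cnj (B1 w) * (1 - B2 z * cnj (B2 w))"
      unfolding E1[OF that] E2[OF that] by (simp add: algebra_simps)
    finally show ?thesis by (simp add: algebra_simps)
  qed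
  then show ?thesis unfolding kernel_rank_le_def by blast
qed

lemma kernel_rank_le_prod:
  assumes "finite A" "\<And>a. a \<in> A \<Longrightarrow> cmod a < 1"
  shows "kernel_rank_le (\<lambda>z. \<Prod>a\<in>A. ((z - a) / (1 - cnj a * z)) ^ r a) (\<Sum>a\<in>A. r a)"
  using assms
proof (induction A rule: finite_induct)
  case empty
  then show ?case using kernel_rank_le_const[of 1] by simp
next
  case (insert a A)
  have "kernel_rank_le (\<lambda>z. ((z - a) / (1 - cnj a * z)) ^ n) n" for n
  proof (induction n)
    case 0
    then show ?case using kernel_rank_le_const[of 1] by simp
  next
    case (Suc n)
    have "kernel_rank_le (\<lambda>z. (z - a) / (1 - cnj a * z) * ((z - a) / (1 - cnj a * z)) ^ n) (1 + n)"
      by (intro kernel_rank_le_mult kernel_rank_le_factor Suc insert.prems) simp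
    then show ?case by simp
  qed
  from kernel_rank_le_mult[OF this[of "r a"] insert.IH] show ?case using insert by simp
qed

text \<open>Supplies the kernel bound for the upper estimate and the local factorisation for the
  lower one. The latter also identifies the exponents of the product with \<open>zorder\<close>, so
  that both sides meet in \<open>blaschke_degree\<close>.\<close>

lemma blaschke_structure:
  assumes "blaschke B"
  obtains r where "finite (zero_set B)" "B holomorphic_on disc"
    "kernel_rank_le B (blaschke_degree B)" "(\<Sum>a\<in>zero_set B. r a) = blaschke_degree B"
    "\<And>a. a \<in> disc \<Longrightarrow> r a = 0 \<longleftrightarrow> a \<notin> zero_set B"
    "\<And>a. a \<in> disc \<Longrightarrow> \<exists>b. b holomorphic_on disc \<and> b a \<noteq> 0 \<and> (\<forall>z\<in>disc. B z = (z - a) ^ r a * b z)"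
proof -
  obtain \<kappa> r where fin: "finite (zero_set B)" and \<kappa>: "cmod \<kappa> = 1"
    and rpos: "\<And>a. a \<in> zero_set B \<Longrightarrow> r a > 0"
    and B: "\<And>z. z \<in> disc \<Longrightarrow> B z = \<kappa> * (\<Prod>a\<in>zero_set B. ((z - a) / (1 - cnj a * z)) ^ r a)"
    by (rule blaschke_factorization[OF assms]) blast
  define A where "A = zero_set B"
  define P where "P = (\<lambda>A z. \<Prod>a\<in>A. ((z - a) / (1 - cnj a * z)) ^ r a)"
  \<comment> \<open>Extension by 0 lets the local factorisation cover points where \<open>B\<close>
    does not vanish, in particular jumps that are not poles.\<close>
  define r' where "r' = (\<lambda>a. if a \<in> A then r a else 0)"
  have Ad: "cmod a < 1" if "a \<in> A" for a using that by (auto simp: A_def zero_set_def disc_def)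
  have nz: "1 - cnj a * z \<noteq> 0" if "a \<in> disc" "z \<in> disc" for a z
    using one_minus_mult_cnj_nonzero(1)[of z a] that by (auto simp: disc_def)
  have hol: "P A' holomorphic_on disc" if "A' \<subseteq> A" for A'
    unfolding P_def using nz Ad that by (intro holomorphic_intros) (auto simp: disc_def)
  have BP: "B z = \<kappa> * P A z" if "z \<in> disc" for z using B[OF that] by (simp add: P_def A_def)
  have holB: "B holomorphic_on disc"
    using BP by (intro holomorphic_transform[OF holomorphic_on_mult[OF holomorphic_on_const hol[OF order_refl]]]) auto
  have local: "\<exists>b. b holomorphic_on disc \<and> b a \<noteq> 0 \<and> (\<forall>z\<in>disc. B z = (z - a) ^ r' a * b z)" if "a \<in> disc" for a
  proof (cases "a \<in> A")
    case True
    define b where "b = (\<lambda>z. \<kappa> * (1 / (1 - cnj a * z)) ^ r a * P (A - {a}) z)"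
    have "b holomorphic_on disc" unfolding b_def using nz[OF that]
      by (intro holomorphic_intros hol) auto
    moreover have "P (A - {a}) a \<noteq> 0" using Ad that fin nz by (auto simp: P_def A_def disc_def)
    then have "b a \<noteq> 0" using \<kappa> nz[OF that that] by (auto simp: b_def)
    moreover have "B z = (z - a) ^ r' a * b z" if "z \<in> disc" for z
    proof -
      have "P A z = ((z - a) / (1 - cnj a * z)) ^ r a * P (A - {a}) z"
        unfolding P_def using fin True by (intro prod.remove) (auto simp: A_def)
      then show ?thesis using True BP[OF that] by (simp add: r'_def b_def power_divide)
    qed
    ultimately show ?thesis by blast
  next
    case False
    then show ?thesis using holB that by (intro exI[of _ B]) (auto simp: r'_def A_def zero_set_def)
  qed
  have ord: "nat (zorder B a) = r' a" if "a \<in> A" for a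
  proof -
    have ad: "a \<in> disc" using that by (auto simp: A_def zero_set_def)
    from local[OF this] obtain b where b: "b holomorphic_on disc" "b a \<noteq> 0"
      "\<And>z. z \<in> disc \<Longrightarrow> B z = (z - a) ^ r' a * b z" by blast
    have "zorder B a = int (r' a)"
      by (rule zorder_eqI[OF _ ad b(1,2)]) (auto simp: disc_def b(3))
    then show ?thesis by simp
  qed
  have deg: "(\<Sum>a\<in>A. r' a) = blaschke_degree B"
    unfolding blaschke_degree_def A_def[symmetric] using ord by simp
  have "kernel_rank_le (\<lambda>z. \<kappa> * P A z) (0 + (\<Sum>a\<in>A. r a))"
    unfolding P_def using \<kappa> fin Ad
    by (intro kernel_rank_le_mult kernel_rank_le_const kernel_rank_le_prod) (auto simp: A_def)
  also have "0 + (\<Sum>a\<in>A. r a) = blaschke_degree B" unfolding deg[symmetric] by (simp add: r'_def)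
  finally have "kernel_rank_le B (blaschke_degree B)"
    unfolding kernel_rank_le_def using BP by simp
  then show ?thesis using fin holB deg local rpos
    by (intro that[of r']) (auto simp: r'_def A_def)
qed

section \<open>Negative squares of Pick matrices\<close>

definition pick_kernel :: "(complex \<Rightarrow> complex) \<Rightarrow> complex \<Rightarrow> complex \<Rightarrow> complex" where
  "pick_kernel f z w = (1 - f z * cnj (f w)) / (1 - z * cnj w)"

definition pick_form :: "(complex \<Rightarrow> complex) \<Rightarrow> complex set \<Rightarrow> (complex \<Rightarrow> complex) \<Rightarrow> real" where
  "pick_form f X c = Re (\<Sum>x\<in>X. \<Sum>y\<in>X. c x * cnj (c y) * pick_kernel f x y)"

lemma pick_matrix_pick_kernel:
  "pick_matrix f zs = mat (length zs) (length zs) (\<lambda>(i, j). pick_kernel f (zs ! i) (zs ! j))"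
  by (simp add: pick_matrix_def pick_kernel_def)

lemma pick_kernel_hermitian: "pick_kernel f w z = cnj (pick_kernel f z w)"
  by (simp add: pick_kernel_def mult.commute)

lemma sum_nth_distinct:
  assumes "distinct zs"
  shows "(\<Sum>i<length zs. g (zs ! i)) = sum g (set zs)"
  by (rule sum.reindex_bij_betw[OF bij_betw_nth]) (use assms in auto)

lemma pick_form_nth:
  assumes "distinct zs"
  shows "Re (\<Sum>i<length zs. \<Sum>j<length zs. c (zs ! i) * cnj (c (zs ! j)) * pick_kernel f (zs ! i) (zs ! j))
    = pick_form f (set zs) c"
  unfolding pick_form_def
  using sum_nth_distinct[OF assms, of "\<lambda>x. \<Sum>j<length zs. c x * cnj (c (zs ! j)) * pick_kernel f x (zs ! j)"]
    sum_nth_distinct[OF assms, of "\<lambda>y. c x * cnj (c y) * pick_kernel f x y" for x] by simp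

lemma sq_neg_pick_matrix_le:
  fixes \<phi> :: "'m \<Rightarrow> complex \<Rightarrow> complex"
  assumes zs: "distinct zs" and "finite M"
    and nonneg: "\<And>c. (\<And>m. m \<in> M \<Longrightarrow> (\<Sum>x\<in>set zs. \<phi> m x * c x) = 0) \<Longrightarrow> 0 \<le> pick_form f (set zs) c"
  shows "sq_neg (pick_matrix f zs) \<le> card M"
  unfolding pick_matrix_pick_kernel
proof (rule sq_neg_le_codimension[where \<phi> = "\<lambda>m i. \<phi> m (zs ! i)", OF _ \<open>finite M\<close>])
  show "\<forall>i<length zs. \<forall>j<length zs. pick_kernel f (zs ! j) (zs ! i) = cnj (pick_kernel f (zs ! i) (zs ! j))"
    using pick_kernel_hermitian by blast
  fix c' assume c': "\<And>m. m \<in> M \<Longrightarrow> (\<Sum>i<length zs. \<phi> m (zs ! i) * c' i) = 0"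
  define c where "c = c' \<circ> inv_into {..<length zs} ((!) zs)"
  have c: "c (zs ! i) = c' i" if "i < length zs" for i
    using zs that by (simp add: c_def inv_into_f_f inj_on_nth)
  have "0 \<le> pick_form f (set zs) c"
  proof (rule nonneg)
    fix m assume "m \<in> M"
    have "(\<Sum>x\<in>set zs. \<phi> m x * c x) = (\<Sum>i<length zs. \<phi> m (zs ! i) * c (zs ! i))"
      using sum_nth_distinct[OF zs, of "\<lambda>x. \<phi> m x * c x"] by simp
    then show "(\<Sum>x\<in>set zs. \<phi> m x * c x) = 0" using c' \<open>m \<in> M\<close> c by simp
  qed
  then show "0 \<le> Re (\<Sum>i<length zs. \<Sum>j<length zs. c' i * cnj (c' j) * pick_kernel f (zs ! i) (zs ! j))"
    unfolding pick_form_nth[OF zs, symmetric] using c by simp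
qed

lemma sq_neg_pick_matrix_ge:
  fixes X :: "'i \<Rightarrow> complex \<Rightarrow> complex"
  assumes zs: "distinct zs" and "finite I"
    and neg: "\<And>t. \<exists>\<iota>\<in>I. t \<iota> \<noteq> 0 \<Longrightarrow> pick_form f (set zs) (\<lambda>x. \<Sum>\<iota>\<in>I. t \<iota> * X \<iota> x) < 0"
  shows "card I \<le> sq_neg (pick_matrix f zs)"
  unfolding pick_matrix_pick_kernel
proof (rule sq_neg_ge_dimension[where X = "\<lambda>\<iota> i. X \<iota> (zs ! i)", OF _ \<open>finite I\<close>])
  show "\<forall>i<length zs. \<forall>j<length zs. pick_kernel f (zs ! j) (zs ! i) = cnj (pick_kernel f (zs ! i) (zs ! j))"
    using pick_kernel_hermitian by blast
  fix t c assume t: "\<exists>\<iota>\<in>I. t \<iota> \<noteq> 0" and c: "c = (\<lambda>i. \<Sum>\<iota>\<in>I. t \<iota> * X \<iota> (zs ! i))"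
  show "Re (\<Sum>i<length zs. \<Sum>j<length zs. c i * cnj (c j) * pick_kernel f (zs ! i) (zs ! j)) < 0"
    using neg[OF t] unfolding pick_form_nth[OF zs, symmetric] c .
qed

lemma sq_neg_pick_matrix_upper_bound:
  assumes zs: "distinct zs" "set zs \<subseteq> disc" and S: "schur_function S" and B: "kernel_rank_le B q"
    and f: "\<And>x. x \<in> set zs - Zs \<Longrightarrow> B x \<noteq> 0 \<and> f x = S x / B x"
  shows "sq_neg (pick_matrix f zs) \<le> q + card (set zs \<inter> Zs)"
proof -
  obtain E where E: "\<And>z w. z \<in> disc \<Longrightarrow> w \<in> disc \<Longrightarrow>
      1 - B z * cnj (B w) = (1 - z * cnj w) * (\<Sum>k<q. E k z * cnj (E k w))"
    using B unfolding kernel_rank_le_def by blast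
  define X where "X = set zs"
  define Y where "Y = X - Zs"
  have fin: "finite X" "finite Y" by (auto simp: X_def Y_def)
  \<comment> \<open>Constraint \<open>Inl a\<close> removes the coefficient at the jump
    \<open>a\<close>; constraint \<open>Inr k\<close> makes the rescaled coefficients
    \<open>c / B\<close> on the remaining nodes annihilate \<open>E k\<close>.\<close>
  define \<phi> where "\<phi> = (\<lambda>m x. case m of Inl a \<Rightarrow> if x = a then 1 else 0 | Inr k \<Rightarrow> if x \<in> Zs then 0 else E k x / B x)"
  have "sq_neg (pick_matrix f zs) \<le> card ((X \<inter> Zs) <+> {..<q})"
  proof (rule sq_neg_pick_matrix_le[where \<phi> = \<phi>, OF zs(1)])
    fix c assume c: "\<And>m. m \<in> (X \<inter> Zs) <+> {..<q} \<Longrightarrow> (\<Sum>x\<in>set zs. \<phi> m x * c x) = 0"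
    have c0: "c a = 0" if "a \<in> X \<inter> Zs" for a
    proof -
      have "(\<Sum>x\<in>X. (if x = a then 1 else 0) * c x) = 0"
        using c[OF InlI[OF that]] by (simp add: \<phi>_def X_def)
      then show ?thesis using that fin by (simp add: if_distrib[of "\<lambda>u. u * _"] sum.delta cong: if_cong)
    qed
    define d where "d = (\<lambda>x. c x / B x)"
    have d0: "(\<Sum>x\<in>Y. d x * E k x) = 0" if "k < q" for k
    proof -
      have "(\<Sum>x\<in>Y. d x * E k x) = (\<Sum>x\<in>X. \<phi> (Inr k) x * c x)"
        using fin by (intro sum.mono_neutral_cong_left) (auto simp: Y_def \<phi>_def d_def)
      then show ?thesis using c[OF InrI, of k] that by (simp add: X_def)
    qed
    \<comment> \<open>After rescaling by \<open>B\<close> the numerator is the defect of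
      \<open>S\<close> minus the defect of \<open>B\<close>; the latter splits into \<open>q\<close>
      squares, each of which the constraints \<open>d0\<close> annihilate.\<close>
    have entry: "c x * cnj (c y) * pick_kernel f x y = d x * cnj (d y) * ((1 - S x * cnj (S y)) / (1 - x * cnj y))
        - (\<Sum>k<q. (d x * E k x) * cnj (d y * E k y))" if "x \<in> Y" "y \<in> Y" for x y
    proof -
      have xy: "x \<in> disc" "y \<in> disc" "B x \<noteq> 0" "B y \<noteq> 0" "f x = S x / B x" "f y = S y / B y"
        using that zs f by (auto simp: Y_def X_def)
      then have nz: "1 - x * cnj y \<noteq> 0" using one_minus_mult_cnj_nonzero(2)[of x y] by (auto simp: disc_def)
      have cd: "c x = d x * B x" "c y = d y * B y" using xy by (auto simp: d_def)
      have BB: "B x * cnj (B y) * (1 - S x / B x * cnj (S y / B y)) = B x * cnj (B y) - S x * cnj (S y)"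
        using xy(3,4) by (simp add: right_diff_distrib)
      have "c x * cnj (c y) * pick_kernel f x y =
          d x * cnj (d y) * (B x * cnj (B y) * (1 - S x / B x * cnj (S y / B y)) / (1 - x * cnj y))"
        unfolding cd pick_kernel_def xy(5,6) by simp
      then have "c x * cnj (c y) * pick_kernel f x y =
          d x * cnj (d y) * ((B x * cnj (B y) - S x * cnj (S y)) / (1 - x * cnj y))"
        unfolding BB .
      also have "B x * cnj (B y) - S x * cnj (S y) =
          (1 - S x * cnj (S y)) - (1 - x * cnj y) * (\<Sum>k<q. E k x * cnj (E k y))"
        using E[OF xy(1,2)] by (simp add: algebra_simps)
      also have "\<dots> / (1 - x * cnj y) = (1 - S x * cnj (S y)) / (1 - x * cnj y) - (\<Sum>k<q. E k x * cnj (E k y))"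
        using nz by (simp add: diff_divide_distrib)
      finally show ?thesis by (simp add: right_diff_distrib sum_distrib_left mult_ac)
    qed
    have "(\<Sum>x\<in>X. \<Sum>y\<in>X. c x * cnj (c y) * pick_kernel f x y) =
        (\<Sum>x\<in>Y. \<Sum>y\<in>Y. c x * cnj (c y) * pick_kernel f x y)"
      using fin c0 by (intro sum.mono_neutral_cong_right ballI sum.neutral) (auto simp: Y_def)
    also have "\<dots> = (\<Sum>x\<in>Y. \<Sum>y\<in>Y. d x * cnj (d y) * ((1 - S x * cnj (S y)) / (1 - x * cnj y)))
        - (\<Sum>x\<in>Y. \<Sum>y\<in>Y. \<Sum>k<q. (d x * E k x) * cnj (d y * E k y))"
      unfolding sum_subtractf[symmetric] by (intro sum.cong refl entry)
    also have "(\<Sum>x\<in>Y. \<Sum>y\<in>Y. \<Sum>k<q. (d x * E k x) * cnj (d y * E k y)) =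
        (\<Sum>x\<in>Y. \<Sum>k<q. \<Sum>y\<in>Y. (d x * E k x) * cnj (d y * E k y))"
      by (intro sum.cong refl sum.swap)
    also have "\<dots> = (\<Sum>x\<in>Y. \<Sum>k<q. (d x * E k x) * cnj (\<Sum>y\<in>Y. d y * E k y))"
      by (simp only: sum_distrib_left cnj_sum)
    also have "\<dots> = 0" using d0 by simp
    finally have "pick_form f X c =
        Re (\<Sum>x\<in>Y. \<Sum>y\<in>Y. d x * cnj (d y) * ((1 - S x * cnj (S y)) / (1 - x * cnj y)))"
      by (simp add: pick_form_def)
    then show "0 \<le> pick_form f (set zs) c"
      using schur_pick_form_nonneg[OF S fin(2), of d] zs by (auto simp: X_def Y_def)
  qed (use fin in auto)
  then show ?thesis using fin by (simp add: card_Plus X_def)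
qed

section \<open>Approximation by Cauchy kernels\<close>

text \<open>Uniform approximability on the circle of radius \<open>R\<close> by combinations of the Cauchy kernels
  \<open>1 / (z - w)\<close> with \<open>w \<in> \<Omega>\<close>; by Cauchy's formula these represent finite combinations of
  point evaluations in \<open>\<Omega>\<close>.\<close>
definition cauchy_approximable :: "real \<Rightarrow> complex set \<Rightarrow> (complex \<Rightarrow> complex) \<Rightarrow> bool" where
  "cauchy_approximable R \<Omega> h \<longleftrightarrow> (\<forall>\<epsilon>>0. \<exists>T d. finite T \<and> T \<subseteq> \<Omega> \<and>
     (\<forall>z. cmod z = R \<longrightarrow> cmod (h z - (\<Sum>w\<in>T. d w / (z - w))) \<le> \<epsilon>))"

lemma cauchy_approximableE:
  assumes "cauchy_approximable R \<Omega> h" "\<epsilon> > 0"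
  obtains T d where "finite T" "T \<subseteq> \<Omega>"
    "\<And>z. cmod z = R \<Longrightarrow> cmod (h z - (\<Sum>w\<in>T. d w / (z - w))) \<le> \<epsilon>"
proof -
  from assms have "\<exists>T d. finite T \<and> T \<subseteq> \<Omega> \<and>
     (\<forall>z. cmod z = R \<longrightarrow> cmod (h z - (\<Sum>w\<in>T. d w / (z - w))) \<le> \<epsilon>)"
    by (simp add: cauchy_approximable_def)
  then show ?thesis by (elim exE conjE) (rule that, auto)
qed

lemma cauchy_approximable_kernel_sum:
  assumes "finite T" "T \<subseteq> \<Omega>"
  shows "cauchy_approximable R \<Omega> (\<lambda>z. \<Sum>w\<in>T. d w / (z - w))"
  unfolding cauchy_approximable_def using assms by (intro allI impI exI[of _ T] exI[of _ d]) auto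

lemma cauchy_approximable_kernel:
  assumes "w \<in> \<Omega>"
  shows "cauchy_approximable R \<Omega> (\<lambda>z. 1 / (z - w))"
  using cauchy_approximable_kernel_sum[of "{w}" \<Omega> R "\<lambda>_. 1"] assms by simp

lemma cauchy_approximable_limit:
  assumes "\<And>\<epsilon>. \<epsilon> > 0 \<Longrightarrow> \<exists>h'. cauchy_approximable R \<Omega> h' \<and> (\<forall>z. cmod z = R \<longrightarrow> cmod (h z - h' z) \<le> \<epsilon>)"
  shows "cauchy_approximable R \<Omega> h"
  unfolding cauchy_approximable_def
proof (intro allI impI)
  fix \<epsilon> :: real assume "\<epsilon> > 0"
  then obtain h' where h': "cauchy_approximable R \<Omega> h'" "\<And>z. cmod z = R \<Longrightarrow> cmod (h z - h' z) \<le> \<epsilon> / 2"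
    using assms[of "\<epsilon> / 2"] by auto
  then obtain T d where T: "finite T" "T \<subseteq> \<Omega>"
    "\<And>z. cmod z = R \<Longrightarrow> cmod (h' z - (\<Sum>w\<in>T. d w / (z - w))) \<le> \<epsilon> / 2"
    using cauchy_approximableE[OF h'(1) half_gt_zero[OF \<open>\<epsilon> > 0\<close>]] by blast
  have "cmod (h z - (\<Sum>w\<in>T. d w / (z - w))) \<le> \<epsilon>" if "cmod z = R" for z
    using norm_triangle_ineq[of "h z - h' z" "h' z - (\<Sum>w\<in>T. d w / (z - w))"] h'(2)[OF that] T(3)[OF that]
    by simp
  then show "\<exists>T d. finite T \<and> T \<subseteq> \<Omega> \<and> (\<forall>z. cmod z = R \<longrightarrow> cmod (h z - (\<Sum>w\<in>T. d w / (z - w))) \<le> \<epsilon>)"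
    using T by blast
qed

lemma cauchy_approximable_cong:
  assumes "\<And>z. cmod z = R \<Longrightarrow> h z = h' z"
  shows "cauchy_approximable R \<Omega> h \<longleftrightarrow> cauchy_approximable R \<Omega> h'"
  using assms by (simp add: cauchy_approximable_def)

lemma cauchy_approximable_scale:
  assumes "cauchy_approximable R \<Omega> h"
  shows "cauchy_approximable R \<Omega> (\<lambda>z. c * h z)"
  unfolding cauchy_approximable_def
proof (intro allI impI)
  fix \<epsilon> :: real assume "\<epsilon> > 0"
  then have pos: "\<epsilon> / (1 + cmod c) > 0" by (simp add: add_pos_nonneg)
  obtain T d where T: "finite T" "T \<subseteq> \<Omega>"
    "\<And>z. cmod z = R \<Longrightarrow> cmod (h z - (\<Sum>w\<in>T. d w / (z - w))) \<le> \<epsilon> / (1 + cmod c)"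
    using cauchy_approximableE[OF assms pos] by blast
  have "cmod (c * h z - (\<Sum>w\<in>T. c * d w / (z - w))) \<le> \<epsilon>" if "cmod z = R" for z
  proof -
    have "c * h z - (\<Sum>w\<in>T. c * d w / (z - w)) = c * (h z - (\<Sum>w\<in>T. d w / (z - w)))"
      by (simp add: right_diff_distrib sum_distrib_left)
    then have "cmod (c * h z - (\<Sum>w\<in>T. c * d w / (z - w))) \<le> cmod c * (\<epsilon> / (1 + cmod c))"
      using mult_left_mono[OF T(3)[OF that], of "cmod c"] by (simp only: norm_mult) simp
    also have "\<dots> \<le> (1 + cmod c) * (\<epsilon> / (1 + cmod c))" using \<open>\<epsilon> > 0\<close> by (intro mult_right_mono) auto
    also have "\<dots> = \<epsilon>" by (simp add: add_pos_nonneg less_imp_neq[symmetric])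
    finally show ?thesis .
  qed
  then show "\<exists>T d. finite T \<and> T \<subseteq> \<Omega> \<and> (\<forall>z. cmod z = R \<longrightarrow> cmod (c * h z - (\<Sum>w\<in>T. d w / (z - w))) \<le> \<epsilon>)"
    using T(1,2) by (intro exI[of _ T] exI[of _ "\<lambda>w. c * d w"]) auto
qed

lemma cauchy_approximable_add:
  assumes "cauchy_approximable R \<Omega> h1" "cauchy_approximable R \<Omega> h2"
  shows "cauchy_approximable R \<Omega> (\<lambda>z. h1 z + h2 z)"
  unfolding cauchy_approximable_def
proof (intro allI impI)
  fix \<epsilon> :: real assume "\<epsilon> > 0"
  then have e2: "\<epsilon> / 2 > 0" by simp
  obtain T1 d1 where T1: "finite T1" "T1 \<subseteq> \<Omega>"
    "\<And>z. cmod z = R \<Longrightarrow> cmod (h1 z - (\<Sum>w\<in>T1. d1 w / (z - w))) \<le> \<epsilon> / 2"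
    using cauchy_approximableE[OF assms(1) e2] by blast
  obtain T2 d2 where T2: "finite T2" "T2 \<subseteq> \<Omega>"
    "\<And>z. cmod z = R \<Longrightarrow> cmod (h2 z - (\<Sum>w\<in>T2. d2 w / (z - w))) \<le> \<epsilon> / 2"
    using cauchy_approximableE[OF assms(2) e2] by blast
  define d where "d = (\<lambda>w. (if w \<in> T1 then d1 w else 0) + (if w \<in> T2 then d2 w else 0))"
  have s: "(\<Sum>w\<in>T1 \<union> T2. d w / (z - w)) = (\<Sum>w\<in>T1. d1 w / (z - w)) + (\<Sum>w\<in>T2. d2 w / (z - w))" for z
  proof -
    have "(\<Sum>w\<in>T1. d1 w / (z - w)) = (\<Sum>w\<in>T1 \<union> T2. (if w \<in> T1 then d1 w else 0) / (z - w))"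
      using T1 T2 by (intro sum.mono_neutral_cong_left) auto
    moreover have "(\<Sum>w\<in>T2. d2 w / (z - w)) = (\<Sum>w\<in>T1 \<union> T2. (if w \<in> T2 then d2 w else 0) / (z - w))"
      using T1 T2 by (intro sum.mono_neutral_cong_left) auto
    ultimately show ?thesis by (simp add: d_def add_divide_distrib sum.distrib)
  qed
  have "cmod (h1 z + h2 z - (\<Sum>w\<in>T1 \<union> T2. d w / (z - w))) \<le> \<epsilon>" if "cmod z = R" for z
    using norm_triangle_ineq[of "h1 z - (\<Sum>w\<in>T1. d1 w / (z - w))" "h2 z - (\<Sum>w\<in>T2. d2 w / (z - w))"]
      T1(3)[OF that] T2(3)[OF that] unfolding s by (simp add: algebra_simps)
  moreover have "finite (T1 \<union> T2)" "T1 \<union> T2 \<subseteq> \<Omega>" using T1 T2 by auto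
  ultimately show "\<exists>T d. finite T \<and> T \<subseteq> \<Omega> \<and>
      (\<forall>z. cmod z = R \<longrightarrow> cmod (h1 z + h2 z - (\<Sum>w\<in>T. d w / (z - w))) \<le> \<epsilon>)" by blast
qed

lemma cauchy_approximable_sum:
  assumes "finite K" "\<And>k. k \<in> K \<Longrightarrow> cauchy_approximable R \<Omega> (h k)"
  shows "cauchy_approximable R \<Omega> (\<lambda>z. \<Sum>k\<in>K. h k z)"
  using assms
proof (induction K rule: finite_induct)
  case empty
  then show ?case using cauchy_approximable_kernel_sum[of "{}"] by simp
next
  case (insert k K)
  then show ?case using cauchy_approximable_add[of R \<Omega> "h k" "\<lambda>z. \<Sum>k\<in>K. h k z"] by simp
qed

lemma circle_dist_pos:
  fixes z w :: complex
  assumes "cmod w < R" "cmod z = R"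
  shows "R - cmod w \<le> cmod (z - w)" "z \<noteq> w"
  using assms norm_triangle_ineq2[of z w] by auto

section \<open>Products and powers of Cauchy kernels\<close>

lemma cauchy_approximable_kernel_mult_distinct:
  assumes "w \<in> \<Omega>" "w' \<in> \<Omega>" "w \<noteq> w'" "\<Omega> \<subseteq> ball 0 R"
  shows "cauchy_approximable R \<Omega> (\<lambda>z. 1 / (z - w) * (1 / (z - w')))"
proof -
  have "cauchy_approximable R \<Omega> (\<lambda>z. 1 / (w - w') * (1 / (z - w)) + - 1 / (w - w') * (1 / (z - w')))"
    using assms by (intro cauchy_approximable_add cauchy_approximable_scale cauchy_approximable_kernel)
  then show ?thesis
  proof (rule cauchy_approximable_cong[THEN iffD1, rotated])
    fix z assume "cmod z = R"
    then have "z \<noteq> w" "z \<noteq> w'" using assms by auto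
    then show "1 / (w - w') * (1 / (z - w)) + - 1 / (w - w') * (1 / (z - w')) = 1 / (z - w) * (1 / (z - w'))"
      using assms(3) by (simp add: divide_simps)
  qed
qed

text \<open>A double pole is the limit of two distinct poles that merge; openness of
  \<open>\<Omega>\<close> provides the second one.\<close>

lemma cauchy_approximable_kernel_square:
  assumes "open \<Omega>" "w \<in> \<Omega>" "\<Omega> \<subseteq> ball 0 R"
  shows "cauchy_approximable R \<Omega> (\<lambda>z. 1 / (z - w) * (1 / (z - w)))"
proof (rule cauchy_approximable_limit)
  fix \<epsilon> :: real assume "\<epsilon> > 0"
  define \<delta> where "\<delta> = R - cmod w"
  have "\<delta> > 0" using assms by (auto simp: \<delta>_def)
  obtain \<rho> where \<rho>: "\<rho> > 0" "ball w \<rho> \<subseteq> \<Omega>" using assms(1,2) openE by blast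
  \<comment> \<open>The three bounds keep \<open>w'\<close> in \<open>\<Omega>\<close>, keep it at
    distance at least \<open>\<delta> / 2\<close> from the circle, and bring the difference of the
    kernels below \<open>\<epsilon>\<close>.\<close>
  define s where "s = min (\<rho> / 2) (min (\<delta> / 2) (\<epsilon> * \<delta> ^ 3 / 2))"
  have s: "s > 0" "s < \<rho>" "s \<le> \<delta> / 2" "s \<le> \<epsilon> * \<delta> ^ 3 / 2" using \<rho> \<open>\<delta> > 0\<close> \<open>\<epsilon> > 0\<close> by (auto simp: s_def)
  define w' where "w' = w + of_real s"
  have w': "w' \<in> \<Omega>" "w' \<noteq> w" "cmod (w - w') = s" using s \<rho> by (auto simp: w'_def dist_norm subset_eq)
  have "cmod (1 / (z - w) * (1 / (z - w)) - 1 / (z - w) * (1 / (z - w'))) \<le> \<epsilon>" if "cmod z = R" for z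
  proof -
    have zw: "\<delta> \<le> cmod (z - w)" "z \<noteq> w" using circle_dist_pos[of w R z] that assms by (auto simp: \<delta>_def)
    have "z - w' \<noteq> 0" using that w'(1) assms(3) by auto
    have zw': "\<delta> / 2 \<le> cmod (z - w')"
      using norm_triangle_ineq2[of "z - w" "w' - w"] zw(1) w'(3) s(3) by (simp add: norm_minus_commute)
    have "1 / (z - w) * (1 / (z - w)) - 1 / (z - w) * (1 / (z - w')) = (w - w') / ((z - w) * (z - w) * (z - w'))"
      using zw(2) \<open>z - w' \<noteq> 0\<close> by (simp add: divide_simps)
    also have "cmod \<dots> \<le> s / (\<delta> * \<delta> * (\<delta> / 2))"
      unfolding norm_divide norm_mult w'(3) using zw(1) zw' \<open>\<delta> > 0\<close> s(1)
      by (intro divide_left_mono mult_mono mult_pos_pos) auto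
    also have "\<dots> \<le> \<epsilon>" using s(4) \<open>\<delta> > 0\<close> by (simp add: field_simps power3_eq_cube)
    finally show ?thesis .
  qed
  moreover have "cauchy_approximable R \<Omega> (\<lambda>z. 1 / (z - w) * (1 / (z - w')))"
    using w' assms by (intro cauchy_approximable_kernel_mult_distinct) auto
  ultimately show "\<exists>h'. cauchy_approximable R \<Omega> h' \<and>
      (\<forall>z. cmod z = R \<longrightarrow> cmod (1 / (z - w) * (1 / (z - w)) - h' z) \<le> \<epsilon>)" by blast
qed

lemma cauchy_approximable_kernel_sum_mult:
  assumes \<Omega>: "open \<Omega>" "\<Omega> \<subseteq> ball 0 R" and T: "finite T" "T \<subseteq> \<Omega>" "finite T'" "T' \<subseteq> \<Omega>"
  shows "cauchy_approximable R \<Omega> (\<lambda>z. (\<Sum>w\<in>T. d w / (z - w)) * (\<Sum>w\<in>T'. d' w / (z - w)))"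
proof -
  have "cauchy_approximable R \<Omega> (\<lambda>z. 1 / (z - w) * (1 / (z - w')))" if "w \<in> T" "w' \<in> T'" for w w'
    using that T \<Omega> cauchy_approximable_kernel_mult_distinct[of w \<Omega> w' R]
      cauchy_approximable_kernel_square[of \<Omega> w R] by (cases "w = w'") auto
  then have "cauchy_approximable R \<Omega> (\<lambda>z. \<Sum>w\<in>T. \<Sum>w'\<in>T'. d w * d' w' * (1 / (z - w) * (1 / (z - w'))))"
    using T by (intro cauchy_approximable_sum cauchy_approximable_scale) auto
  then show ?thesis by (simp add: sum_product)
qed

lemma cauchy_approximable_bounded:
  assumes "cauchy_approximable R \<Omega> h" "\<Omega> \<subseteq> ball 0 R"
  obtains C where "C > 0" "\<And>z. cmod z = R \<Longrightarrow> cmod (h z) \<le> C"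
proof -
  obtain T d where T: "finite T" "T \<subseteq> \<Omega>"
    "\<And>z. cmod z = R \<Longrightarrow> cmod (h z - (\<Sum>w\<in>T. d w / (z - w))) \<le> 1"
    using cauchy_approximableE[OF assms(1), of 1] by auto
  define C where "C = 1 + (\<Sum>w\<in>T. cmod (d w) / (R - cmod w))"
  have pos: "R - cmod w > 0" if "w \<in> T" for w using that T assms by auto
  have "cmod (h z) \<le> C" if "cmod z = R" for z
  proof -
    have "cmod (\<Sum>w\<in>T. d w / (z - w)) \<le> (\<Sum>w\<in>T. cmod (d w) / (R - cmod w))"
    proof (rule sum_norm_le)
      fix w assume "w \<in> T"
      then show "cmod (d w / (z - w)) \<le> cmod (d w) / (R - cmod w)"
        using pos[of w] circle_dist_pos[of w R z] that unfolding norm_divide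
        by (intro divide_left_mono) (auto intro!: mult_pos_pos)
    qed
    then show ?thesis
      using T(3)[OF that] norm_triangle_ineq[of "h z - (\<Sum>w\<in>T. d w / (z - w))" "\<Sum>w\<in>T. d w / (z - w)"]
      by (simp add: C_def)
  qed
  moreover have "C > 0" using pos unfolding C_def
    by (intro add_pos_nonneg sum_nonneg divide_nonneg_pos) auto
  ultimately show ?thesis using that by blast
qed

text \<open>Products are needed because shifting a pole expands in powers of a kernel whose own pole
  may already be outside \<open>\<Omega>\<close>. Approximable functions are bounded on the circle,
  so the factors can be replaced by finite kernel sums one at a time.\<close>

lemma cauchy_approximable_mult:
  assumes \<Omega>: "open \<Omega>" "\<Omega> \<subseteq> ball 0 R"
    and h: "cauchy_approximable R \<Omega> h1" "cauchy_approximable R \<Omega> h2"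
  shows "cauchy_approximable R \<Omega> (\<lambda>z. h1 z * h2 z)"
proof -
  have lim: "cauchy_approximable R \<Omega> (\<lambda>z. h z * g z)"
    if h: "cauchy_approximable R \<Omega> h" and g: "cauchy_approximable R \<Omega> g"
      and fin: "\<And>T d. finite T \<Longrightarrow> T \<subseteq> \<Omega> \<Longrightarrow> cauchy_approximable R \<Omega> (\<lambda>z. h z * (\<Sum>w\<in>T. d w / (z - w)))"
    for h g
  proof (rule cauchy_approximable_limit)
    fix \<epsilon> :: real assume "\<epsilon> > 0"
    obtain C where C: "C > 0" "\<And>z. cmod z = R \<Longrightarrow> cmod (h z) \<le> C"
      using cauchy_approximable_bounded[OF h \<Omega>(2)] by blast
    then have pos: "\<epsilon> / C > 0" using \<open>\<epsilon> > 0\<close> by simp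
    obtain T d where T: "finite T" "T \<subseteq> \<Omega>"
      "\<And>z. cmod z = R \<Longrightarrow> cmod (g z - (\<Sum>w\<in>T. d w / (z - w))) \<le> \<epsilon> / C"
      using cauchy_approximableE[OF g pos] by blast
    have "cmod (h z * g z - h z * (\<Sum>w\<in>T. d w / (z - w))) \<le> \<epsilon>" if "cmod z = R" for z
    proof -
      have "cmod (h z * g z - h z * (\<Sum>w\<in>T. d w / (z - w))) = cmod (h z) * cmod (g z - (\<Sum>w\<in>T. d w / (z - w)))"
        by (simp add: norm_mult[symmetric] right_diff_distrib)
      also have "\<dots> \<le> C * (\<epsilon> / C)" using C T(3)[OF that] that by (intro mult_mono) auto
      finally show ?thesis using C by simp
    qed
    then show "\<exists>h'. cauchy_approximable R \<Omega> h' \<and> (\<forall>z. cmod z = R \<longrightarrow> cmod (h z * g z - h' z) \<le> \<epsilon>)"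
      using fin[OF T(1,2), of d] by blast
  qed
  show ?thesis
  proof (rule lim[OF h])
    fix T d assume T: "finite T" "T \<subseteq> \<Omega>"
    have "cauchy_approximable R \<Omega> (\<lambda>z. (\<Sum>w\<in>T. d w / (z - w)) * h1 z)"
      by (rule lim[OF cauchy_approximable_kernel_sum[OF T] h(1) cauchy_approximable_kernel_sum_mult[OF \<Omega> T]])
    then show "cauchy_approximable R \<Omega> (\<lambda>z. h1 z * (\<Sum>w\<in>T. d w / (z - w)))" by (simp add: mult.commute)
  qed
qed

lemma cauchy_approximable_power_Suc:
  assumes "open \<Omega>" "\<Omega> \<subseteq> ball 0 R" "cauchy_approximable R \<Omega> h"
  shows "cauchy_approximable R \<Omega> (\<lambda>z. h z ^ Suc n)"
proof (induction n)
  case 0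
  show ?case using assms(3) by simp
next
  case (Suc n)
  from cauchy_approximable_mult[OF assms this] show ?case by simp
qed

text \<open>Geometric expansion of \<open>1 / (z - a)\<close> in powers of \<open>1 / (z - b)\<close>.\<close>
lemma cauchy_approximable_shift_pole:
  assumes \<Omega>: "open \<Omega>" "\<Omega> \<subseteq> ball 0 R" and b: "cauchy_approximable R \<Omega> (\<lambda>z. 1 / (z - b))"
    and ab: "cmod (a - b) < R - cmod b"
  shows "cauchy_approximable R \<Omega> (\<lambda>z. 1 / (z - a))"
proof (rule cauchy_approximable_limit)
  fix \<epsilon> :: real assume "\<epsilon> > 0"
  define \<delta> where "\<delta> = R - cmod b"
  have "\<delta> > 0" "cmod b < R" using ab norm_ge_zero[of "a - b"] by (auto simp: \<delta>_def simp del: norm_ge_zero)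
  have aR: "cmod a < R" using ab norm_triangle_ineq[of "a - b" b] by simp
  define \<theta> where "\<theta> = cmod (a - b) / \<delta>"
  have \<theta>: "0 \<le> \<theta>" "\<theta> < 1" using ab \<open>\<delta> > 0\<close> by (auto simp: \<theta>_def \<delta>_def[symmetric])
  obtain n where n: "\<theta> ^ n < \<epsilon> * (R - cmod a)"
    using real_arch_pow_inv[of "\<epsilon> * (R - cmod a)" \<theta>] \<theta> \<open>\<epsilon> > 0\<close> aR by auto
  define s where "s = (\<lambda>z. \<Sum>k<n. (a - b) ^ k * (1 / (z - b)) ^ Suc k)"
  have "cauchy_approximable R \<Omega> s" unfolding s_def
    by (intro cauchy_approximable_sum cauchy_approximable_scale cauchy_approximable_power_Suc \<Omega> b) auto
  moreover have "cmod (1 / (z - a) - s z) \<le> \<epsilon>" if "cmod z = R" for z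
  proof -
    define u where "u = 1 / (z - b)"
    define x where "x = (a - b) * u"
    have zb: "\<delta> \<le> cmod (z - b)" "z \<noteq> b" using circle_dist_pos[OF \<open>cmod b < R\<close> that] by (auto simp: \<delta>_def)
    have za: "R - cmod a \<le> cmod (z - a)" "z \<noteq> a" using circle_dist_pos[OF aR that] by auto
    have x1: "1 - x = (z - a) * u" using zb by (simp add: x_def u_def field_simps)
    then have "x \<noteq> 1" using za zb by (auto simp: u_def)
    have "s z = u * (\<Sum>k<n. x ^ k)"
      unfolding s_def x_def u_def sum_distrib_left by (simp add: power_mult_distrib mult_ac power_divide)
    also have "(\<Sum>k<n. x ^ k) = (1 - x ^ n) / (1 - x)" using \<open>x \<noteq> 1\<close> by (simp add: sum_gp_strict)
    also have "u * ((1 - x ^ n) / (1 - x)) = (1 - x ^ n) / (z - a)" using zb za unfolding x1 by (simp add: u_def)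
    finally have "1 / (z - a) - s z = x ^ n / (z - a)" by (simp add: diff_divide_distrib)
    then have "cmod (1 / (z - a) - s z) = cmod x ^ n / cmod (z - a)" by (simp add: norm_divide norm_power)
    also have "\<dots> \<le> \<theta> ^ n / (R - cmod a)"
    proof (intro frac_le power_mono)
      show "cmod x \<le> \<theta>" using zb \<open>\<delta> > 0\<close> unfolding x_def u_def \<theta>_def norm_mult norm_divide
        by (simp add: frac_le)
    qed (use aR za \<theta> in auto)
    also have "\<dots> \<le> \<epsilon>" using n aR by (simp add: field_simps)
    finally show ?thesis .
  qed
  ultimately show "\<exists>h'. cauchy_approximable R \<Omega> h' \<and> (\<forall>z. cmod z = R \<longrightarrow> cmod (1 / (z - a) - h' z) \<le> \<epsilon>)" by blast
qed

text \<open>Pole pushing along the segment from a point of \<open>\<Omega>\<close> to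
  \<open>a\<close>. By convexity the segment stays in the closed disc of radius
  \<open>\<rho> < R\<close>, so each intermediate pole is at distance at least
  \<open>R - \<rho>\<close> from the circle, and \<open>n\<close> is chosen to make every step
  shorter than that.\<close>

lemma cauchy_approximable_pole:
  assumes \<Omega>: "open \<Omega>" "\<Omega> \<subseteq> ball 0 R" "\<Omega> \<noteq> {}" and a: "cmod a < R"
  shows "cauchy_approximable R \<Omega> (\<lambda>z. 1 / (z - a) ^ Suc i)"
proof -
  obtain w where w: "w \<in> \<Omega>" using \<Omega> by blast
  define \<rho> where "\<rho> = max (cmod w) (cmod a)"
  have "\<rho> < R" using w \<Omega> a by (auto simp: \<rho>_def)
  obtain n where n: "cmod (a - w) / (R - \<rho>) < real n" using reals_Archimedean2 by blast
  have "0 \<le> cmod (a - w) / (R - \<rho>)" using \<open>\<rho> < R\<close> by simp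
  then have "n > 0" using n by (cases "n = 0") auto
  define b where "b = (\<lambda>k. w + of_real (real k / real n) * (a - w))"
  have b\<rho>: "cmod (b k) \<le> \<rho>" if "k \<le> n" for k
  proof -
    define t where "t = real k / real n"
    have t: "0 \<le> t" "t \<le> 1" using that \<open>n > 0\<close> by (auto simp: t_def)
    have "b k = of_real (1 - t) * w + of_real t * a" unfolding b_def t_def[symmetric] by (simp add: algebra_simps)
    then have "cmod (b k) \<le> (1 - t) * cmod w + t * cmod a"
      using t norm_triangle_ineq[of "of_real (1 - t) * w" "of_real t * a"] by (simp add: norm_mult del: of_real_diff)
    also have "\<dots> \<le> (1 - t) * \<rho> + t * \<rho>" using t by (intro add_mono mult_left_mono) (auto simp: \<rho>_def)
    finally show ?thesis by (simp add: algebra_simps)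
  qed
  have step: "cmod (b (Suc k) - b k) < R - \<rho>" for k
  proof -
    have "b (Suc k) - b k = of_real (real (Suc k) / real n - real k / real n) * (a - w)"
      unfolding b_def of_real_diff left_diff_distrib by simp
    also have "real (Suc k) / real n - real k / real n = 1 / real n"
      by (simp add: diff_divide_distrib[symmetric])
    finally have "b (Suc k) - b k = of_real (1 / real n) * (a - w)" .
    then have "cmod (b (Suc k) - b k) = cmod (a - w) / real n" by (simp add: norm_mult norm_divide)
    moreover have "cmod (a - w) < real n * (R - \<rho>)" using n \<open>\<rho> < R\<close> by (simp add: pos_divide_less_eq)
    ultimately show ?thesis using \<open>n > 0\<close> by (simp add: pos_divide_less_eq mult.commute)
  qed
  have "cauchy_approximable R \<Omega> (\<lambda>z. 1 / (z - b k))" if "k \<le> n" for k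
    using that
  proof (induction k)
    case 0
    then show ?case using cauchy_approximable_kernel[OF w] by (simp add: b_def)
  next
    case (Suc k)
    then have "cmod (b (Suc k) - b k) < R - cmod (b k)" using step[of k] b\<rho>[of k] by simp
    moreover have "cauchy_approximable R \<Omega> (\<lambda>z. 1 / (z - b k))" using Suc by simp
    ultimately show ?case using cauchy_approximable_shift_pole[OF \<Omega>(1,2)] by blast
  qed
  from this[of n] have "cauchy_approximable R \<Omega> (\<lambda>z. 1 / (z - a))" using \<open>n > 0\<close> by (simp add: b_def)
  from cauchy_approximable_power_Suc[OF \<Omega>(1,2) this, of i] show ?thesis by (simp only: power_divide power_one)
qed

section \<open>Negative squares forced by poles and jumps\<close>

definition taylor_coeff :: "nat \<Rightarrow> complex \<Rightarrow> (complex \<Rightarrow> complex) \<Rightarrow> complex" where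
  "taylor_coeff i a F = (deriv ^^ i) F a / fact i"

lemma taylor_coeff_contour_integral:
  assumes F: "F holomorphic_on disc" and R: "cmod a < R" "R < 1"
  shows "((\<lambda>z. F z / (z - a) ^ Suc i) has_contour_integral 2 * of_real pi * \<i> * taylor_coeff i a F) (circlepath 0 R)"
proof -
  have "cball 0 R \<subseteq> disc" "ball 0 R \<subseteq> disc" using R by (auto simp: disc_def)
  then have "continuous_on (cball 0 R) F" "F holomorphic_on ball 0 R"
    using F holomorphic_on_imp_continuous_on holomorphic_on_subset by blast+
  from Cauchy_has_contour_integral_higher_derivative_circlepath[OF this, of a i] R
  show ?thesis by (simp add: taylor_coeff_def)
qed

lemma taylor_coeff_unique:
  assumes F: "F holomorphic_on disc" and R: "cmod a < R" "R < 1"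
    and "((\<lambda>z. F z / (z - a) ^ Suc i) has_contour_integral 2 * of_real pi * \<i> * c) (circlepath 0 R)"
  shows "taylor_coeff i a F = c"
  using contour_integral_unique[OF taylor_coeff_contour_integral[OF F R, of i]] contour_integral_unique[OF assms(4)]
  by simp

text \<open>Cancelling \<open>(z - a) ^ i\<close> in Cauchy's formula leaves the value at
  \<open>a\<close> of \<open>(z - a) ^ (k - i) * H z\<close>. The case \<open>i = k\<close> is
  included since a jump uses the coefficient whose index is the full order of the zero.\<close>

lemma taylor_coeff_zero_factor:
  assumes H: "H holomorphic_on disc" and F: "\<And>z. z \<in> disc \<Longrightarrow> F z = (z - a) ^ k * H z"
    and a: "a \<in> disc" and "i \<le> k"
  shows "taylor_coeff i a F = (if i = k then H a else 0)"
proof -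
  obtain R where R: "cmod a < R" "R < 1" using a dense[of "cmod a" 1] by (auto simp: disc_def)
  have holF: "F holomorphic_on disc"
    by (rule holomorphic_transform[of "\<lambda>z. (z - a) ^ k * H z"]) (use F H in \<open>auto intro!: holomorphic_intros\<close>)
  define G where "G = (\<lambda>z. (z - a) ^ (k - i) * H z)"
  have "G holomorphic_on disc" unfolding G_def using H by (intro holomorphic_intros)
  from taylor_coeff_contour_integral[OF this R, of 0]
  have "((\<lambda>z. G z / (z - a)) has_contour_integral 2 * of_real pi * \<i> * G a) (circlepath 0 R)"
    by (simp add: taylor_coeff_def)
  then have "((\<lambda>z. F z / (z - a) ^ Suc i) has_contour_integral 2 * of_real pi * \<i> * G a) (circlepath 0 R)"
  proof (rule has_contour_integral_eq)
    fix z assume "z \<in> path_image (circlepath 0 R)"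
    then have z: "cmod z = R" using R norm_ge_zero[of a] by (simp add: path_image_circlepath sphere_def dist_norm)
    then have "z \<in> disc" "z \<noteq> a" using R by (auto simp: disc_def)
    moreover have "(z - a) ^ k = (z - a) ^ (k - i) * (z - a) ^ i"
      using \<open>i \<le> k\<close> by (simp flip: power_add)
    ultimately show "G z / (z - a) = F z / (z - a) ^ Suc i" by (simp add: F G_def)
  qed
  from taylor_coeff_unique[OF holF R this] show ?thesis using \<open>i \<le> k\<close> by (simp add: G_def)
qed

lemma taylor_coeff_sum:
  assumes "finite M" "\<And>m. m \<in> M \<Longrightarrow> F m holomorphic_on disc" and a: "a \<in> disc"
  shows "taylor_coeff i a (\<lambda>z. \<Sum>m\<in>M. c m * F m z) = (\<Sum>m\<in>M. c m * taylor_coeff i a (F m))"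
proof -
  obtain R where R: "cmod a < R" "R < 1" using a dense[of "cmod a" 1] by (auto simp: disc_def)
  have hol: "(\<lambda>z. \<Sum>m\<in>M. c m * F m z) holomorphic_on disc" using assms by (intro holomorphic_intros)
  have "((\<lambda>z. \<Sum>m\<in>M. c m * (F m z / (z - a) ^ Suc i)) has_contour_integral
      (\<Sum>m\<in>M. c m * (2 * of_real pi * \<i> * taylor_coeff i a (F m)))) (circlepath 0 R)"
    using assms R by (intro has_contour_integral_sum has_contour_integral_lmul taylor_coeff_contour_integral) auto
  moreover have "(\<Sum>m\<in>M. c m * (2 * of_real pi * \<i> * taylor_coeff i a (F m))) =
      2 * of_real pi * \<i> * (\<Sum>m\<in>M. c m * taylor_coeff i a (F m))"
    by (simp add: sum_distrib_left mult_ac)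
  moreover have "(\<Sum>m\<in>M. c m * (F m z / (z - a) ^ Suc i)) = (\<Sum>m\<in>M. c m * F m z) / (z - a) ^ Suc i" for z
    by (simp only: sum_divide_distrib times_divide_eq_right)
  ultimately show ?thesis by (intro taylor_coeff_unique[OF hol R]) simp
qed

text \<open>Both functionals integrate \<open>F\<close> over the same circle, so a uniform bound on
  the difference of their kernels suffices. The weights \<open>d\<close> do not depend on
  \<open>F\<close>: one choice serves \<open>z ^ m * B\<close> and \<open>z ^ m * S\<close> for all
  \<open>m\<close>.\<close>

lemma taylor_coeff_approximation:
  assumes F: "F holomorphic_on disc" and R: "cmod a < R" "R < 1"
    and T: "finite T" "T \<subseteq> ball 0 R"
    and d: "\<And>z. cmod z = R \<Longrightarrow> cmod (1 / (z - a) ^ Suc i - (\<Sum>w\<in>T. d w / (z - w))) \<le> \<epsilon>"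
    and C: "\<And>z. cmod z = R \<Longrightarrow> cmod (F z) \<le> C"
  shows "cmod (taylor_coeff i a F - (\<Sum>w\<in>T. d w * F w)) \<le> \<epsilon> * C"
proof -
  have R0: "R > 0" using R norm_ge_zero[of a] by linarith
  define D where "D = taylor_coeff i a F - (\<Sum>w\<in>T. d w * F w)"
  have "((\<lambda>z. F z / (z - w)) has_contour_integral 2 * of_real pi * \<i> * F w) (circlepath 0 R)" if "w \<in> T" for w
    using taylor_coeff_contour_integral[OF F _ R(2), of w 0] that T by (auto simp: taylor_coeff_def)
  then have "((\<lambda>z. F z / (z - a) ^ Suc i - (\<Sum>w\<in>T. d w * (F z / (z - w)))) has_contour_integral
      2 * of_real pi * \<i> * taylor_coeff i a F - (\<Sum>w\<in>T. d w * (2 * of_real pi * \<i> * F w))) (circlepath 0 R)"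
    using T by (intro has_contour_integral_diff has_contour_integral_sum has_contour_integral_lmul
        taylor_coeff_contour_integral F R) auto
  moreover have "2 * of_real pi * \<i> * taylor_coeff i a F - (\<Sum>w\<in>T. d w * (2 * of_real pi * \<i> * F w)) =
      2 * of_real pi * \<i> * D"
    unfolding D_def right_diff_distrib sum_distrib_left by (simp add: mult_ac)
  ultimately have int: "((\<lambda>z. F z / (z - a) ^ Suc i - (\<Sum>w\<in>T. d w * (F z / (z - w)))) has_contour_integral
      2 * of_real pi * \<i> * D) (circlepath 0 R)" by simp
  have e0: "0 \<le> \<epsilon>" "0 \<le> C"
    using order_trans[OF norm_ge_zero d[of "of_real R"]] order_trans[OF norm_ge_zero C[of "of_real R"]] R0 by auto
  have "cmod (2 * of_real pi * \<i> * D) \<le> (\<epsilon> * C) * (2 * pi * R)"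
  proof (rule has_contour_integral_bound_circlepath[OF int])
    fix z :: complex assume "cmod (z - 0) = R"
    then have z: "cmod z = R" by simp
    have "F z / (z - a) ^ Suc i - (\<Sum>w\<in>T. d w * (F z / (z - w))) =
        (1 / (z - a) ^ Suc i - (\<Sum>w\<in>T. d w / (z - w))) * F z"
      unfolding left_diff_distrib sum_distrib_right by (simp add: mult.commute)
    also have "cmod \<dots> \<le> \<epsilon> * C" unfolding norm_mult using d[OF z] C[OF z] e0 by (intro mult_mono) auto
    finally show "cmod (F z / (z - a) ^ Suc i - (\<Sum>w\<in>T. d w * (F z / (z - w)))) \<le> \<epsilon> * C" .
  qed (use R0 e0 in auto)
  then have "2 * pi * cmod D \<le> 2 * pi * (\<epsilon> * C * R)" by (simp add: norm_mult mult_ac)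
  then have "cmod D \<le> \<epsilon> * C * R" by simp
  also have "\<dots> \<le> \<epsilon> * C * 1" using e0 R by (intro mult_left_mono) auto
  finally show ?thesis by (simp add: D_def)
qed

section \<open>Moments and negative directions\<close>

lemma pick_form_sums:
  assumes "finite X" "X \<subseteq> disc"
  shows "(\<lambda>m. (cmod (\<Sum>x\<in>X. c x * x ^ m))\<^sup>2 - (cmod (\<Sum>x\<in>X. c x * f x * x ^ m))\<^sup>2) sums pick_form f X c"
proof -
  have "(\<lambda>m. \<Sum>x\<in>X. \<Sum>y\<in>X. c x * cnj (c y) * (1 - f x * cnj (f y)) * (x * cnj y) ^ m) sums
      (\<Sum>x\<in>X. \<Sum>y\<in>X. c x * cnj (c y) * (1 - f x * cnj (f y)) * (1 / (1 - x * cnj y)))"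
  proof (intro sums_sum sums_mult geometric_sums)
    fix x y assume "x \<in> X" "y \<in> X"
    then have "cmod x < 1" "cmod y < 1" using assms by (auto simp: disc_def)
    then show "cmod (x * cnj y) < 1"
      using mult_strict_mono[of "cmod x" 1 "cmod y" 1] by (simp add: norm_mult)
  qed
  from sums_Re[OF this] have "(\<lambda>m. Re (\<Sum>x\<in>X. \<Sum>y\<in>X. c x * cnj (c y) * (1 - f x * cnj (f y)) * (x * cnj y) ^ m))
      sums pick_form f X c" by (simp add: pick_form_def pick_kernel_def)
  moreover have "Re (\<Sum>x\<in>X. \<Sum>y\<in>X. c x * cnj (c y) * (1 - f x * cnj (f y)) * (x * cnj y) ^ m) =
      (cmod (\<Sum>x\<in>X. c x * x ^ m))\<^sup>2 - (cmod (\<Sum>x\<in>X. c x * f x * x ^ m))\<^sup>2" for m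
  proof -
    have "(\<Sum>x\<in>X. \<Sum>y\<in>X. c x * cnj (c y) * (1 - f x * cnj (f y)) * (x * cnj y) ^ m) =
        (\<Sum>x\<in>X. \<Sum>y\<in>X. (c x * x ^ m) * cnj (c y * y ^ m)) -
        (\<Sum>x\<in>X. \<Sum>y\<in>X. (c x * f x * x ^ m) * cnj (c y * f y * y ^ m))"
      unfolding sum_subtractf[symmetric] by (intro sum.cong refl) (simp add: algebra_simps power_mult_distrib)
    also have "\<dots> = (\<Sum>x\<in>X. c x * x ^ m) * cnj (\<Sum>x\<in>X. c x * x ^ m) -
        (\<Sum>x\<in>X. c x * f x * x ^ m) * cnj (\<Sum>x\<in>X. c x * f x * x ^ m)"
      by (simp only: cnj_sum sum_product)
    also have "\<dots> = of_real ((cmod (\<Sum>x\<in>X. c x * x ^ m))\<^sup>2 - (cmod (\<Sum>x\<in>X. c x * f x * x ^ m))\<^sup>2)"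
      by (simp only: complex_norm_square of_real_diff)
    finally show ?thesis by (simp only: Re_complex_of_real)
  qed
  ultimately show ?thesis by simp
qed

text \<open>The moments of the limiting functionals: a jump at \<open>a\<close> with value \<open>f a\<close> contributes a point
  mass at \<open>a\<close>, weighted so that it cancels the top Taylor coefficient of \<open>z ^ m * B\<close>.
  Testing against \<open>p\<close> isolates the highest index \<open>k\<close> with nonzero coefficient at a point \<open>a\<close>.\<close>
lemma pole_jump_moments_trivial_kernel:
  fixes r :: "complex \<Rightarrow> nat" and b f :: "complex \<Rightarrow> complex"
  assumes S: "S holomorphic_on disc" and P: "finite P" "P \<subseteq> disc" "J \<subseteq> P"
    and N: "N = (\<lambda>a. r a + (if a \<in> J then 1 else 0))" and I: "I = Sigma P (\<lambda>a. {..<N a})"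
    and pole: "\<And>a. a \<in> P \<Longrightarrow> r a > 0 \<Longrightarrow> S a \<noteq> 0"
    and jump: "\<And>a. a \<in> J \<Longrightarrow> r a = 0 \<Longrightarrow> S a \<noteq> b a * f a"
    and V: "V = (\<lambda>m (a, i). taylor_coeff i a (\<lambda>z. z ^ m * S z) - (if i = r a then b a * f a * a ^ m else 0))"
  shows "\<exists>D. \<forall>t. (\<forall>m<D. (\<Sum>\<iota>\<in>I. V m \<iota> * t \<iota>) = 0) \<longrightarrow> (\<forall>\<iota>\<in>I. t \<iota> = 0)"
proof -
  \<comment> \<open>The zeros have just the order needed to kill every functional at the other
    points of \<open>P\<close> and those at \<open>a\<close> of index below
    \<open>k\<close>.\<close>
  define p where "p = (\<lambda>(a, k). [:- a, 1:] ^ k * (\<Prod>a'\<in>P - {a}. [:- a', 1:] ^ N a') :: complex poly)"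
  \<comment> \<open>Larger than every degree, so moments below \<open>D\<close> determine the
    pairing with each test polynomial.\<close>
  define D where "D = Suc (\<Sum>\<iota>\<in>I. degree (p \<iota>))"
  have finI: "finite I" using P by (simp add: I)
  show ?thesis
  proof (intro exI[of _ D] allI impI ballI)
    fix t \<iota>0 assume t: "\<forall>m<D. (\<Sum>\<iota>\<in>I. V m \<iota> * t \<iota>) = 0" and "\<iota>0 \<in> I"
    show "t \<iota>0 = 0"
    proof (rule ccontr)
      assume "t \<iota>0 \<noteq> 0"
      obtain a i0 where ai0: "\<iota>0 = (a, i0)" by (cases \<iota>0)
      define K where "K = {i. i < N a \<and> t (a, i) \<noteq> 0}"
      define k where "k = Max K"
      have "finite K" "i0 \<in> K" using \<open>\<iota>0 \<in> I\<close> \<open>t \<iota>0 \<noteq> 0\<close> by (auto simp: K_def ai0 I)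
      then have "k \<in> K" unfolding k_def by (intro Max_in) auto
      then have k: "k < N a" "t (a, k) \<noteq> 0" by (auto simp: K_def)
      have kmax: "t (a, i) = 0" if "i < N a" "k < i" for i
      proof (rule ccontr)
        assume "t (a, i) \<noteq> 0"
        then have "i \<in> K" using that by (simp add: K_def)
        then show False using Max_ge[OF \<open>finite K\<close>, of i] that by (simp add: k_def)
      qed
      have aP: "a \<in> P" "a \<in> disc" using \<open>\<iota>0 \<in> I\<close> P by (auto simp: ai0 I)
      have akI: "(a, k) \<in> I" using k aP by (simp add: I)
      define q where "q = p (a, k)"
      have "degree q \<le> (\<Sum>\<iota>\<in>I. degree (p \<iota>))"
        unfolding q_def using akI finI by (intro member_le_sum) auto
      then have dq: "degree q < D" by (simp add: D_def)
      define H where "H = (\<lambda>z. (\<Prod>a'\<in>P - {a}. (z - a') ^ N a'))"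
      have qz: "poly q z = (z - a) ^ k * H z" for z by (simp add: q_def p_def H_def poly_prod)
      have Ha: "H a \<noteq> 0" using P by (auto simp: H_def)
      \<comment> \<open>\<open>V\<close> extended linearly from the monomials to
        \<open>q\<close>.\<close>
      define W where "W = (\<lambda>(a, i). taylor_coeff i a (\<lambda>z. poly q z * S z) - (if i = r a then b a * f a * poly q a else 0))"
      have q_sum: "poly q z = (\<Sum>m<D. coeff q m * z ^ m)" for z
        unfolding poly_altdef using dq by (intro sum.mono_neutral_left) (auto simp: coeff_eq_0)
      have W_sum: "W \<iota> = (\<Sum>m<D. coeff q m * V m \<iota>)" if "\<iota> \<in> I" for \<iota>
      proof -
        obtain a' i where \<iota>: "\<iota> = (a', i)" by (cases \<iota>)
        have a': "a' \<in> disc" using that P by (auto simp: \<iota> I)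
        have "taylor_coeff i a' (\<lambda>z. poly q z * S z) = taylor_coeff i a' (\<lambda>z. \<Sum>m<D. coeff q m * (z ^ m * S z))"
          by (simp add: q_sum sum_distrib_right mult.assoc)
        also have "\<dots> = (\<Sum>m<D. coeff q m * taylor_coeff i a' (\<lambda>z. z ^ m * S z))"
          by (intro taylor_coeff_sum a') (auto intro!: holomorphic_intros S)
        finally show ?thesis
          by (simp add: \<iota> W_def V q_sum right_diff_distrib sum_subtractf sum_distrib_left mult_ac)
      qed
      have "(\<Sum>\<iota>\<in>I. W \<iota> * t \<iota>) = (\<Sum>\<iota>\<in>I. \<Sum>m<D. coeff q m * (V m \<iota> * t \<iota>))"
        using W_sum by (intro sum.cong refl) (simp add: sum_distrib_right mult.assoc)
      also have "\<dots> = (\<Sum>m<D. coeff q m * (\<Sum>\<iota>\<in>I. V m \<iota> * t \<iota>))"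
        unfolding sum_distrib_left by (rule sum.swap)
      also have "\<dots> = 0" using t by simp
      finally have sum0: "(\<Sum>\<iota>\<in>I. W \<iota> * t \<iota>) = 0" .
      have W0: "W \<iota> * t \<iota> = 0" if "\<iota> \<in> I" "\<iota> \<noteq> (a, k)" for \<iota>
      proof -
        obtain a' i where \<iota>: "\<iota> = (a', i)" by (cases \<iota>)
        have a': "a' \<in> P" "a' \<in> disc" "i < N a'" using that P by (auto simp: \<iota> I)
        show ?thesis
        proof (cases "a' = a")
          case False
          define G where "G = (\<lambda>z. (z - a) ^ k * (\<Prod>a''\<in>P - {a} - {a'}. (z - a'') ^ N a'') * S z)"
          have "H z = (z - a') ^ N a' * (\<Prod>a''\<in>P - {a} - {a'}. (z - a'') ^ N a'')" for z
            unfolding H_def using False a' P by (intro prod.remove) auto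
          then have "poly q z * S z = (z - a') ^ N a' * G z" for z by (simp add: qz G_def)
          then have "taylor_coeff i a' (\<lambda>z. poly q z * S z) = (if i = N a' then G a' else 0)"
            using a' by (intro taylor_coeff_zero_factor) (auto simp: G_def intro!: holomorphic_intros S)
          moreover have "poly q a' = 0" using False a' P by (auto simp: qz H_def prod_zero_iff)
          ultimately show ?thesis using a' by (simp add: \<iota> W_def)
        next
          case True
          then have "i \<noteq> k" using that \<iota> by auto
          then consider "i < k" | "k < i" by linarith
          then show ?thesis
          proof cases
            case 1
            have "taylor_coeff i a (\<lambda>z. poly q z * S z) = (if i = k then H a * S a else 0)"
              using 1 aP by (intro taylor_coeff_zero_factor[where H = "\<lambda>z. H z * S z"])
                (auto simp: qz H_def intro!: holomorphic_intros S)
            moreover have "poly q a = 0" using 1 by (simp add: qz)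
            ultimately show ?thesis using 1 True by (simp add: \<iota> W_def)
          next
            case 2
            then show ?thesis using kmax a' True by (simp add: \<iota>)
          qed
        qed
      qed
      have "(\<Sum>\<iota>\<in>I. W \<iota> * t \<iota>) = W (a, k) * t (a, k)"
      proof -
        have "(\<Sum>\<iota>\<in>I - {(a, k)}. W \<iota> * t \<iota>) = 0" by (intro sum.neutral ballI W0) auto
        then show ?thesis using sum.remove[OF finI akI, of "\<lambda>\<iota>. W \<iota> * t \<iota>"] by simp
      qed
      with sum0 k have "W (a, k) = 0" by simp
      moreover have "taylor_coeff k a (\<lambda>z. poly q z * S z) = (if k = k then H a * S a else 0)"
        using aP by (intro taylor_coeff_zero_factor[where H = "\<lambda>z. H z * S z"])
          (auto simp: qz H_def intro!: holomorphic_intros S)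
      ultimately have W_ak: "H a * S a = (if k = r a then b a * f a * poly q a else 0)" by (simp add: W_def)
      \<comment> \<open>If \<open>r a = 0\<close>, then \<open>a\<close> is a jump,
        \<open>k = 0\<close> and \<open>W (a, 0) = H a * (S a - b a * f a)\<close>. Otherwise the
        correction vanishes, since \<open>q\<close> has a zero at \<open>a\<close> when
        \<open>k = r a\<close>, and \<open>W (a, k) = H a * S a\<close>.\<close>
      show False
      proof (cases "r a = 0")
        case True
        then have "a \<in> J" "k = 0" using k by (auto simp: N split: if_splits)
        then show False using W_ak Ha jump[of a] True by (simp add: qz)
      next
        case False
        then have "S a \<noteq> 0" using pole aP by simp
        moreover have "k = r a \<Longrightarrow> poly q a = 0" using False by (simp add: qz)
        ultimately show False using W_ak Ha by (auto split: if_splits)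
      qed
    qed
  qed
qed

text \<open>Here \<open>b a\<close> is the value at \<open>a\<close> of the cofactor of
  \<open>(z - a) ^ r a\<close> in \<open>B\<close>; it is \<open>B a\<close> when
  \<open>r a = 0\<close>, so \<open>jump\<close> says that \<open>f a\<close> is not the value
  prescribed by \<open>B * f = S\<close>. The perturbation argument is asymmetric: one large moment
  \<open>V m\<close> suffices for the negative part, while all moments \<open>U m\<close> must be
  small in the square-summable sense.\<close>

lemma sq_neg_pick_matrix_lower_bound:
  fixes r :: "complex \<Rightarrow> nat" and b f :: "complex \<Rightarrow> complex"
  assumes S: "S holomorphic_on disc" and B: "B holomorphic_on disc"
    and P: "finite P" "P \<subseteq> disc" "J \<subseteq> P"
    and N: "N = (\<lambda>a. r a + (if a \<in> J then 1 else 0))" and I: "I = Sigma P (\<lambda>a. {..<N a})"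
    and pole: "\<And>a. a \<in> P \<Longrightarrow> r a > 0 \<Longrightarrow> S a \<noteq> 0"
    and jump: "\<And>a. a \<in> J \<Longrightarrow> r a = 0 \<Longrightarrow> S a \<noteq> b a * f a"
    and b: "\<And>a. a \<in> P \<Longrightarrow> \<exists>H. H holomorphic_on disc \<and> H a = b a \<and> (\<forall>z\<in>disc. B z = (z - a) ^ r a * H z)"
    and \<Omega>: "open \<Omega>" "\<Omega> \<noteq> {}" "\<Omega> \<subseteq> disc" "\<Omega> \<inter> J = {}"
    and f: "\<And>w. w \<in> \<Omega> \<Longrightarrow> B w * f w = S w"
  shows "\<exists>zs. zs \<noteq> [] \<and> distinct zs \<and> set zs \<subseteq> \<Omega> \<union> J \<and> card I \<le> sq_neg (pick_matrix f zs)"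
proof -
  obtain w0 where w0: "w0 \<in> \<Omega>" using \<Omega> by blast
  \<comment> \<open>The circle of radius \<open>R\<close> must enclose all of \<open>P\<close>, for
    Cauchy's formula, and also \<open>w0\<close>, to keep \<open>\<Omega>1\<close> nonempty.\<close>
  define \<rho> where "\<rho> = Max (cmod ` insert w0 P)"
  have "\<rho> < 1" unfolding \<rho>_def using P w0 \<Omega> by (subst Max_less_iff) (auto simp: disc_def)
  then obtain R where R: "\<rho> < R" "R < 1" using dense by blast
  have PR: "cmod a < R" if "a \<in> insert w0 P" for a
    using Max_ge[of "cmod ` insert w0 P" "cmod a"] P that R by (auto simp: \<rho>_def)
  have R0: "0 < R" using PR[of w0] norm_ge_zero[of w0] by (simp del: norm_ge_zero)
  define \<Omega>1 where "\<Omega>1 = \<Omega> \<inter> ball 0 R"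
  have \<Omega>1: "open \<Omega>1" "\<Omega>1 \<subseteq> ball 0 R" "\<Omega>1 \<noteq> {}" "w0 \<in> \<Omega>1" using \<Omega> w0 PR[of w0] by (auto simp: \<Omega>1_def)
  have finI: "finite I" using P by (simp add: I)
  define V where "V = (\<lambda>m (a, i). taylor_coeff i a (\<lambda>z. z ^ m * S z) - (if i = r a then b a * f a * a ^ m else 0))"
  obtain D0 where D0: "\<And>t. \<forall>m<D0. (\<Sum>\<iota>\<in>I. V m \<iota> * t \<iota>) = 0 \<Longrightarrow> \<forall>\<iota>\<in>I. t \<iota> = 0"
    using pole_jump_moments_trivial_kernel[OF S P N I pole jump V_def] by blast
  \<comment> \<open>Ensures \<open>D > 0\<close>, as \<open>\<kappa>\<close> has \<open>D\<close> in
    its denominator.\<close>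
  define D where "D = Suc D0"
  have "\<forall>\<iota>\<in>I. t \<iota> = 0" if "\<forall>m\<in>{..<D}. (\<Sum>\<iota>\<in>I. V m \<iota> * t \<iota>) = 0" for t
    using that by (intro D0) (auto simp: D_def)
  then obtain K where K: "K > 0"
    "\<And>t. (\<Sum>\<iota>\<in>I. cmod (t \<iota>)) \<le> K * (\<Sum>m<D. cmod (\<Sum>\<iota>\<in>I. V m \<iota> * t \<iota>))"
    using trivial_kernel_bound[of "{..<D}" I V] finI by blast
  have "compact (B ` sphere 0 R)" "compact (S ` sphere 0 R)"
    using R S B by (auto intro!: compact_continuous_image holomorphic_on_imp_continuous_on
        elim!: holomorphic_on_subset simp: disc_def)
  then have "bounded (B ` sphere 0 R \<union> S ` sphere 0 R)" by (simp add: compact_imp_bounded)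
  then obtain C where C: "C > 0" "\<And>z. cmod z = R \<Longrightarrow> cmod (B z) \<le> C" "\<And>z. cmod z = R \<Longrightarrow> cmod (S z) \<le> C"
    unfolding bounded_pos by auto
  \<comment> \<open>With \<open>\<tau>\<close> the sum of the \<open>cmod (t \<iota>)\<close>, the
    bound \<open>K\<close> forces one of the first \<open>D\<close> limiting moments to be at least
    \<open>2 * \<kappa> * \<tau>\<close>. The choice of \<open>e\<close> costs at most half of it
    and keeps the positive part at
    \<open>e\<^sup>2 / (1 - R\<^sup>2) = \<kappa>\<^sup>2 / 4\<close>, times
    \<open>\<tau>\<^sup>2\<close>. Division by \<open>C\<close> converts an error of moments into an
    error of kernels.\<close>
  define \<kappa> where "\<kappa> = 1 / (2 * K * real D)"
  define e where "e = \<kappa> * sqrt (1 - R\<^sup>2) / 2"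
  define \<epsilon> where "\<epsilon> = e / C"
  have R2: "R\<^sup>2 < 1" using R R0 by (simp add: power_less_one_iff)
  have "\<kappa> > 0" using K by (simp add: \<kappa>_def D_def)
  have "sqrt (1 - R\<^sup>2) \<le> 1" "sqrt (1 - R\<^sup>2) > 0" using R2 by auto
  then have e: "e > 0" "e \<le> \<kappa>"
    using \<open>\<kappa> > 0\<close> mult_left_le[of "sqrt (1 - R\<^sup>2)" \<kappa>] unfolding e_def by (simp, linarith)
  have "e\<^sup>2 = \<kappa>\<^sup>2 / 4 * (1 - R\<^sup>2)" using R2 by (simp add: e_def power_divide power_mult_distrib)
  then have e2: "e\<^sup>2 / (1 - R\<^sup>2) = \<kappa>\<^sup>2 / 4" using R2 by simp
  have "\<epsilon> > 0" using e C by (simp add: \<epsilon>_def)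
  have "\<forall>\<iota>\<in>I. \<exists>Td. finite (fst Td) \<and> fst Td \<subseteq> \<Omega>1 \<and> (\<forall>z. cmod z = R \<longrightarrow>
      cmod (1 / (z - fst \<iota>) ^ Suc (snd \<iota>) - (\<Sum>w\<in>fst Td. snd Td w / (z - w))) \<le> \<epsilon>)"
  proof
    fix \<iota> assume "\<iota> \<in> I"
    then have "cmod (fst \<iota>) < R" using PR by (auto simp: I)
    from cauchy_approximableE[OF cauchy_approximable_pole[OF \<Omega>1(1,2,3) this, of "snd \<iota>"] \<open>\<epsilon> > 0\<close>]
    obtain T d where "finite T" "T \<subseteq> \<Omega>1"
      "\<And>z. cmod z = R \<Longrightarrow> cmod (1 / (z - fst \<iota>) ^ Suc (snd \<iota>) - (\<Sum>w\<in>T. d w / (z - w))) \<le> \<epsilon>" by blast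
    then show "\<exists>Td. finite (fst Td) \<and> fst Td \<subseteq> \<Omega>1 \<and> (\<forall>z. cmod z = R \<longrightarrow>
      cmod (1 / (z - fst \<iota>) ^ Suc (snd \<iota>) - (\<Sum>w\<in>fst Td. snd Td w / (z - w))) \<le> \<epsilon>)"
      by (intro exI[of _ "(T, d)"]) auto
  qed
  from bchoice[OF this] obtain Td where Td: "\<forall>\<iota>\<in>I. finite (fst (Td \<iota>)) \<and> fst (Td \<iota>) \<subseteq> \<Omega>1 \<and> (\<forall>z. cmod z = R \<longrightarrow>
      cmod (1 / (z - fst \<iota>) ^ Suc (snd \<iota>) - (\<Sum>w\<in>fst (Td \<iota>). snd (Td \<iota>) w / (z - w))) \<le> \<epsilon>)" by blast
  define T where "T = (\<lambda>\<iota>. fst (Td \<iota>))"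
  define d where "d = (\<lambda>\<iota>. snd (Td \<iota>))"
  have T: "finite (T \<iota>)" "T \<iota> \<subseteq> \<Omega>1" and
    d: "\<And>z. cmod z = R \<Longrightarrow> cmod (1 / (z - fst \<iota>) ^ Suc (snd \<iota>) - (\<Sum>w\<in>T \<iota>. d \<iota> w / (z - w))) \<le> \<epsilon>"
    if "\<iota> \<in> I" for \<iota>
    using Td that by (auto simp: T_def d_def)
  \<comment> \<open>\<open>w0\<close> makes the list of nodes nonempty even when \<open>I\<close> is
    empty.\<close>
  define X where "X = insert w0 (\<Union>\<iota>\<in>I. T \<iota>) \<union> J"
  \<comment> \<open>The factor \<open>B x\<close> replaces evaluation of \<open>g\<close> by
    evaluation of \<open>B * g\<close>; the mass \<open>- b x\<close> cancels the coefficient of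
    index \<open>r x\<close> of \<open>z ^ m * B\<close>, which is
    \<open>b x * x ^ m\<close>.\<close>
  define Y where "Y = (\<lambda>\<iota> x. if x \<in> J then (if \<iota> = (x, r x) then - b x else 0)
    else (if x \<in> T \<iota> then d \<iota> x else 0) * B x)"
  have finJ: "finite J" using P finite_subset by blast
  have finX: "finite X" using T finI finJ by (auto simp: X_def)
  have \<Omega>1J: "\<Omega>1 \<inter> J = {}" using \<Omega> by (auto simp: \<Omega>1_def)
  have X\<Omega>: "X \<subseteq> \<Omega> \<union> J" using T(2) w0 by (auto simp: X_def \<Omega>1_def)
  have Xdisc: "X \<subseteq> disc" using X\<Omega> \<Omega>(3) P(2,3) by blast
  have Y_sum: "(\<Sum>x\<in>X. Y \<iota> x * g x) = (\<Sum>w\<in>T \<iota>. d \<iota> w * (B w * g w))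
      - (if snd \<iota> = r (fst \<iota>) then b (fst \<iota>) * g (fst \<iota>) else 0)" if "\<iota> \<in> I" for \<iota> g
  proof -
    obtain a i where \<iota>: "\<iota> = (a, i)" by (cases \<iota>)
    have ai: "i < N a" using that by (auto simp: \<iota> I)
    have "(\<Sum>x\<in>X. Y \<iota> x * g x) = (\<Sum>x\<in>X - J. Y \<iota> x * g x) + (\<Sum>x\<in>J. Y \<iota> x * g x)"
      using finX by (intro sum.subset_diff) (auto simp: X_def)
    also have "(\<Sum>x\<in>X - J. Y \<iota> x * g x) = (\<Sum>w\<in>T \<iota>. d \<iota> w * (B w * g w))"
      using T[OF that] that \<Omega>1J finX
      by (intro sum.mono_neutral_cong_right) (auto simp: X_def Y_def)
    also have "(\<Sum>x\<in>J. Y \<iota> x * g x) = (\<Sum>x\<in>J. if x = a then (if i = r a then - b a * g a else 0) else 0)"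
      by (intro sum.cong refl) (auto simp: Y_def \<iota>)
    also have "\<dots> = (if a \<in> J then (if i = r a then - b a * g a else 0) else 0)"
      using finJ by simp
    \<comment> \<open>An index \<open>i = r a\<close> below \<open>N a\<close> occurs only at a
      jump.\<close>
    also have "\<dots> = - (if i = r a then b a * g a else 0)" using ai by (auto simp: N)
    finally show ?thesis by (simp add: \<iota>)
  qed
  \<comment> \<open>Applied twice: with \<open>F = z ^ m * B\<close> and \<open>g = z ^ m\<close>,
    then with \<open>F = z ^ m * S\<close> and \<open>g = f * z ^ m\<close>.\<close>
  have approx: "cmod (taylor_coeff (snd \<iota>) (fst \<iota>) F - (if snd \<iota> = r (fst \<iota>) then b (fst \<iota>) * g (fst \<iota>) else 0)
      - (\<Sum>x\<in>X. Y \<iota> x * g x)) \<le> \<epsilon> * C'"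
    if "\<iota> \<in> I" "F holomorphic_on disc" "\<And>w. w \<in> \<Omega>1 \<Longrightarrow> F w = B w * g w" "\<And>z. cmod z = R \<Longrightarrow> cmod (F z) \<le> C'"
    for \<iota> F g C'
  proof -
    have "cmod (fst \<iota>) < R" using that(1) PR by (auto simp: I)
    have "(\<Sum>w\<in>T \<iota>. d \<iota> w * (B w * g w)) = (\<Sum>w\<in>T \<iota>. d \<iota> w * F w)"
      using T(2)[OF that(1)] that(3) by (intro sum.cong) auto
    moreover have "cmod (taylor_coeff (snd \<iota>) (fst \<iota>) F - (\<Sum>w\<in>T \<iota>. d \<iota> w * F w)) \<le> \<epsilon> * C'"
      using T[OF that(1)] \<Omega>1(2) d[OF that(1)] that(4)
      by (intro taylor_coeff_approximation[OF that(2) \<open>cmod (fst \<iota>) < R\<close> R(2)]) auto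
    ultimately show ?thesis unfolding Y_sum[OF that(1)] by simp
  qed
  have neg: "pick_form f X (\<lambda>x. \<Sum>\<iota>\<in>I. t \<iota> * Y \<iota> x) < 0" if t: "\<exists>\<iota>\<in>I. t \<iota> \<noteq> 0" for t
  proof -
    define c where "c = (\<lambda>x. \<Sum>\<iota>\<in>I. t \<iota> * Y \<iota> x)"
    define \<tau> where "\<tau> = (\<Sum>\<iota>\<in>I. cmod (t \<iota>))"
    obtain \<iota>0 where "\<iota>0 \<in> I" "t \<iota>0 \<noteq> 0" using t by blast
    then have "\<tau> > 0" unfolding \<tau>_def using finI by (intro sum_pos2[of _ \<iota>0]) auto
    have moment: "cmod ((\<Sum>\<iota>\<in>I. v \<iota> * t \<iota>) - (\<Sum>x\<in>X. c x * g x)) \<le> \<epsilon> * C' * \<tau>"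
      if "\<And>\<iota>. \<iota> \<in> I \<Longrightarrow> cmod (v \<iota> - (\<Sum>x\<in>X. Y \<iota> x * g x)) \<le> \<epsilon> * C'" for v g C'
    proof -
      have "(\<Sum>x\<in>X. c x * g x) = (\<Sum>x\<in>X. \<Sum>\<iota>\<in>I. (Y \<iota> x * g x) * t \<iota>)"
        unfolding c_def sum_distrib_right by (simp add: mult_ac)
      also have "\<dots> = (\<Sum>\<iota>\<in>I. (\<Sum>x\<in>X. Y \<iota> x * g x) * t \<iota>)"
        unfolding sum_distrib_right by (rule sum.swap)
      finally have "(\<Sum>\<iota>\<in>I. v \<iota> * t \<iota>) - (\<Sum>x\<in>X. c x * g x) = (\<Sum>\<iota>\<in>I. (v \<iota> - (\<Sum>x\<in>X. Y \<iota> x * g x)) * t \<iota>)"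
        by (simp add: left_diff_distrib sum_subtractf)
      also have "cmod \<dots> \<le> (\<Sum>\<iota>\<in>I. \<epsilon> * C' * cmod (t \<iota>))"
        using that by (intro sum_norm_le) (simp add: norm_mult mult_right_mono)
      finally show ?thesis by (simp add: \<tau>_def sum_distrib_left)
    qed
    \<comment> \<open>The decay \<open>R ^ m\<close> is what makes the squared moments in
      \<open>U\<close> summable.\<close>
    have normm: "cmod (z ^ m * F z) \<le> C * R ^ m" if "cmod z = R" "cmod (F z) \<le> C" for z m and F :: "complex \<Rightarrow> complex"
      using that R0 by (simp add: norm_mult norm_power mult.commute mult_left_mono)
    have U: "cmod (\<Sum>x\<in>X. c x * x ^ m) \<le> e * \<tau> * R ^ m" for m
    proof -
      have "cmod (0 - (\<Sum>x\<in>X. Y \<iota> x * x ^ m)) \<le> \<epsilon> * (C * R ^ m)" if "\<iota> \<in> I" for \<iota>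
      proof -
        obtain a i where \<iota>: "\<iota> = (a, i)" by (cases \<iota>)
        have a: "a \<in> P" "a \<in> disc" "i \<le> r a" using that P by (auto simp: \<iota> I N split: if_splits)
        obtain H where H: "H holomorphic_on disc" "H a = b a" "\<And>z. z \<in> disc \<Longrightarrow> B z = (z - a) ^ r a * H z"
          using b[OF a(1)] by blast
        have "taylor_coeff i a (\<lambda>z. z ^ m * B z) = (if i = r a then a ^ m * H a else 0)"
          using a H by (intro taylor_coeff_zero_factor[where H = "\<lambda>z. z ^ m * H z"]) (auto intro!: holomorphic_intros)
        then have z: "taylor_coeff (snd \<iota>) (fst \<iota>) (\<lambda>z. z ^ m * B z) -
            (if snd \<iota> = r (fst \<iota>) then b (fst \<iota>) * fst \<iota> ^ m else 0) = 0"
          using H(2) by (simp add: \<iota>)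
        have "cmod (taylor_coeff (snd \<iota>) (fst \<iota>) (\<lambda>z. z ^ m * B z) -
            (if snd \<iota> = r (fst \<iota>) then b (fst \<iota>) * fst \<iota> ^ m else 0) - (\<Sum>x\<in>X. Y \<iota> x * x ^ m)) \<le> \<epsilon> * (C * R ^ m)"
          using B C normm by (intro approx that) (auto intro!: holomorphic_intros simp: mult.commute)
        then show ?thesis unfolding z .
      qed
      from moment[OF this] have "cmod (\<Sum>x\<in>X. c x * x ^ m) \<le> \<epsilon> * (C * R ^ m) * \<tau>" by simp
      then show ?thesis using C by (simp add: \<epsilon>_def mult_ac)
    qed
    have Vm: "cmod ((\<Sum>\<iota>\<in>I. V m \<iota> * t \<iota>) - (\<Sum>x\<in>X. c x * f x * x ^ m)) \<le> e * \<tau>" for m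
    proof -
      have "cmod (V m \<iota> - (\<Sum>x\<in>X. Y \<iota> x * (f x * x ^ m))) \<le> \<epsilon> * (C * R ^ m)" if "\<iota> \<in> I" for \<iota>
      proof -
        have V\<iota>: "V m \<iota> = taylor_coeff (snd \<iota>) (fst \<iota>) (\<lambda>z. z ^ m * S z) -
            (if snd \<iota> = r (fst \<iota>) then b (fst \<iota>) * (f (fst \<iota>) * fst \<iota> ^ m) else 0)"
          by (cases \<iota>) (simp add: V_def mult.assoc)
        show ?thesis
          unfolding V\<iota>
        proof (rule approx[OF that])
          show "z ^ m * S z = B z * (f z * z ^ m)" if "z \<in> \<Omega>1" for z
            using f[of z] that by (simp add: \<Omega>1_def mult_ac flip: f)
        qed (use S C normm in \<open>auto intro!: holomorphic_intros\<close>)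
      qed
      from moment[OF this]
      have "cmod ((\<Sum>\<iota>\<in>I. V m \<iota> * t \<iota>) - (\<Sum>x\<in>X. c x * f x * x ^ m)) \<le> e * R ^ m * \<tau>"
        using C by (simp add: \<epsilon>_def mult_ac)
      \<comment> \<open>Decay can be given up here, as only one of these moments is used.\<close>
      also have "\<dots> \<le> e * 1 * \<tau>"
        using e \<open>\<tau> > 0\<close> R R0 by (intro mult_right_mono mult_left_mono power_le_one) auto
      finally show ?thesis by simp
    qed
    have "\<exists>m<D. 2 * \<kappa> * \<tau> \<le> cmod (\<Sum>\<iota>\<in>I. V m \<iota> * t \<iota>)"
    proof (rule ccontr)
      assume "\<not> ?thesis"
      then have "(\<Sum>m<D. cmod (\<Sum>\<iota>\<in>I. V m \<iota> * t \<iota>)) < (\<Sum>m<D. 2 * \<kappa> * \<tau>)"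
        by (intro sum_strict_mono) (auto simp: D_def)
      also have "\<dots> = \<tau> / K" using K by (simp add: \<kappa>_def D_def)
      finally show False using K(2)[of t] K(1) by (simp add: \<tau>_def[symmetric] field_simps)
    qed
    then obtain m0 where m0: "2 * \<kappa> * \<tau> \<le> cmod (\<Sum>\<iota>\<in>I. V m0 \<iota> * t \<iota>)" by blast
    have "e * \<tau> \<le> \<kappa> * \<tau>" using e \<open>\<tau> > 0\<close> by simp
    then have Vm0: "\<kappa> * \<tau> \<le> cmod (\<Sum>x\<in>X. c x * f x * x ^ m0)"
      using m0 Vm[of m0] norm_triangle_ineq2[of "\<Sum>\<iota>\<in>I. V m0 \<iota> * t \<iota>" "\<Sum>x\<in>X. c x * f x * x ^ m0"] by linarith
    \<comment> \<open>All positive terms are summed as a geometric series; of the negative ones only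
      that of index \<open>m0\<close> is kept.\<close>
    have "pick_form f X c \<le> (e * \<tau>)\<^sup>2 * (1 / (1 - R\<^sup>2)) - (\<kappa> * \<tau>)\<^sup>2"
    proof (rule sums_le[OF _ pick_form_sums[OF finX Xdisc]])
      have "(\<lambda>m. (e * \<tau>)\<^sup>2 * (R\<^sup>2) ^ m) sums ((e * \<tau>)\<^sup>2 * (1 / (1 - R\<^sup>2)))"
        using R2 by (intro sums_mult geometric_sums) simp
      moreover have "(\<lambda>m. if m = m0 then (\<kappa> * \<tau>)\<^sup>2 else 0) sums (\<kappa> * \<tau>)\<^sup>2" by (rule sums_single)
      ultimately show "(\<lambda>m. (e * \<tau>)\<^sup>2 * (R\<^sup>2) ^ m - (if m = m0 then (\<kappa> * \<tau>)\<^sup>2 else 0)) sums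
          ((e * \<tau>)\<^sup>2 * (1 / (1 - R\<^sup>2)) - (\<kappa> * \<tau>)\<^sup>2)" by (rule sums_diff)
      fix m
      have "(cmod (\<Sum>x\<in>X. c x * x ^ m))\<^sup>2 \<le> (e * \<tau> * R ^ m)\<^sup>2" by (intro power_mono U) auto
      also have "\<dots> = (e * \<tau>)\<^sup>2 * (R\<^sup>2) ^ m" by (simp add: power_mult_distrib power_mult[symmetric] mult.commute)
      finally have 1: "(cmod (\<Sum>x\<in>X. c x * x ^ m))\<^sup>2 \<le> (e * \<tau>)\<^sup>2 * (R\<^sup>2) ^ m" .
      have 2: "(if m = m0 then (\<kappa> * \<tau>)\<^sup>2 else 0) \<le> (cmod (\<Sum>x\<in>X. c x * f x * x ^ m))\<^sup>2"
        using power_mono[OF Vm0, of 2] \<open>\<kappa> > 0\<close> \<open>\<tau> > 0\<close> by simp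
      show "(cmod (\<Sum>x\<in>X. c x * x ^ m))\<^sup>2 - (cmod (\<Sum>x\<in>X. c x * f x * x ^ m))\<^sup>2
          \<le> (e * \<tau>)\<^sup>2 * (R\<^sup>2) ^ m - (if m = m0 then (\<kappa> * \<tau>)\<^sup>2 else 0)" using 1 2 by linarith
    qed
    also have "(e * \<tau>)\<^sup>2 * (1 / (1 - R\<^sup>2)) = e\<^sup>2 / (1 - R\<^sup>2) * \<tau>\<^sup>2" by (simp add: power_mult_distrib)
    also have "\<dots> - (\<kappa> * \<tau>)\<^sup>2 = - (3 / 4) * (\<kappa> * \<tau>)\<^sup>2" unfolding e2 by (simp add: power_mult_distrib)
    also have "\<dots> < 0" using \<open>\<kappa> > 0\<close> \<open>\<tau> > 0\<close> by simp
    finally show ?thesis by (simp add: c_def)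
  qed
  obtain zs where zs: "set zs = X" "distinct zs" using finite_distinct_list[OF finX] by blast
  have "card I \<le> sq_neg (pick_matrix f zs)"
    using neg by (intro sq_neg_pick_matrix_ge[OF zs(2) finI, where X = Y]) (simp add: zs(1))
  moreover have "zs \<noteq> []" using zs by (auto simp: X_def)
  ultimately show ?thesis using zs X\<Omega> by blast
qed

section \<open>Comparison of the two bounds\<close>

theorem mainTheorem5:
  fixes f g S B :: "complex \<Rightarrow> complex" and \<gamma> :: "complex \<Rightarrow> complex"
    and L Zs W \<Omega> :: "complex set" and \<kappa> :: nat
  assumes "discrete_in_disc L"
    and "in_S_kappa \<kappa> L f"
    and "standard_function g S B Zs \<gamma> W"
    and "W \<subseteq> L"
    and "\<forall>z\<in>disc - L. g z = f z"
    and "Zs \<subseteq> disc - L"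
    and "open \<Omega>" and "\<Omega> \<noteq> {}" and "\<Omega> \<subseteq> disc - L"
  shows "\<exists>n>0. k_n n f \<Omega> = blaschke_degree B + card (Zs \<inter> \<Omega>)"
proof -
  have std: "finite Zs" "finite W" "Zs \<subseteq> disc" "blaschke B" "schur_function S" "W \<subseteq> zero_set B"
    "zero_set B \<subseteq> W \<union> Zs" "zero_set B \<inter> zero_set S = {}"
    and jump: "\<And>z. z \<in> Zs \<Longrightarrow> z \<notin> zero_set B \<Longrightarrow> S z / B z \<noteq> \<gamma> z"
    and g: "\<And>z. z \<in> disc - W \<Longrightarrow> g z = (if z \<in> Zs then \<gamma> z else S z / B z)"
    using assms(3) unfolding standard_function_def by blast+
  have \<Omega>disc: "\<Omega> \<subseteq> disc" using assms by blast
  have f\<Omega>: "f z = (if z \<in> Zs then \<gamma> z else S z / B z)" if "z \<in> \<Omega>" for z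
  proof -
    have "z \<in> disc - L" "z \<in> disc - W" using that assms(4,9) by blast+
    then show ?thesis using g[of z] assms(5) by simp
  qed
  obtain r where finB: "finite (zero_set B)" and holB: "B holomorphic_on disc"
    and rank: "kernel_rank_le B (blaschke_degree B)" and deg: "(\<Sum>a\<in>zero_set B. r a) = blaschke_degree B"
    and r0: "\<And>a. a \<in> disc \<Longrightarrow> r a = 0 \<longleftrightarrow> a \<notin> zero_set B"
    and loc: "\<And>a. a \<in> disc \<Longrightarrow> \<exists>b. b holomorphic_on disc \<and> b a \<noteq> 0 \<and> (\<forall>z\<in>disc. B z = (z - a) ^ r a * b z)"
    by (rule blaschke_structure[OF std(4)]) blast
  define J where "J = Zs \<inter> \<Omega>"
  \<comment> \<open>Every zero of \<open>B\<close> enters, wherever it lies, but only the jumps in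
    \<open>\<Omega>\<close>. A zero of \<open>B\<close> that is also such a jump gets one index more
    than its order.\<close>
  define P where "P = zero_set B \<union> J"
  define N where "N = (\<lambda>a. r a + (if a \<in> J then 1 else 0))"
  define I where "I = Sigma P (\<lambda>a. {..<N a})"
  have finJ: "finite J" using std by (simp add: J_def)
  have P: "finite P" "P \<subseteq> disc" "J \<subseteq> P"
    using finB finJ std(3) by (auto simp: P_def J_def zero_set_def)
  have "card I = (\<Sum>a\<in>P. r a) + (\<Sum>a\<in>P. if a \<in> J then 1 else 0)"
    using P by (simp add: I_def N_def sum.distrib)
  also have "(\<Sum>a\<in>P. r a) = blaschke_degree B"
    unfolding deg[symmetric] using P r0 by (intro sum.mono_neutral_right) (auto simp: P_def)
  also have "(\<Sum>a\<in>P. if a \<in> J then 1 else 0) = card J"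
    using P by (simp add: sum.inter_restrict[symmetric] Int_absorb1)
  finally have cardI: "card I = blaschke_degree B + card J" .
  have "\<forall>a\<in>P. \<exists>v. \<exists>H. H holomorphic_on disc \<and> H a = v \<and> (\<forall>z\<in>disc. B z = (z - a) ^ r a * H z)"
    using loc P by blast
  from bchoice[OF this] obtain b where
    b: "\<And>a. a \<in> P \<Longrightarrow> \<exists>H. H holomorphic_on disc \<and> H a = b a \<and> (\<forall>z\<in>disc. B z = (z - a) ^ r a * H z)"
    by blast
  have S\<Omega>: "B z \<noteq> 0 \<and> f z = S z / B z" if "z \<in> \<Omega> - Zs" for z
  proof -
    have "z \<in> disc" "z \<notin> W" using that \<Omega>disc assms(4,9) by auto
    then have "B z \<noteq> 0" using std(7) that by (auto simp: zero_set_def)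
    then show ?thesis using f\<Omega> that by auto
  qed
  \<comment> \<open>The approximation takes place in \<open>\<Omega> - Zs\<close>, where
    \<open>f\<close> is \<open>S / B\<close>; removing finitely many points keeps the set open and
    nonempty, and the jumps in \<open>\<Omega>\<close> return through \<open>J\<close>.\<close>
  have "\<exists>zs. zs \<noteq> [] \<and> distinct zs \<and> set zs \<subseteq> (\<Omega> - Zs) \<union> J \<and> card I \<le> sq_neg (pick_matrix f zs)"
  proof (rule sq_neg_pick_matrix_lower_bound[OF _ holB P N_def I_def _ _ b])
    show "S holomorphic_on disc" using std(5) by (simp add: schur_function_def)
    show "S a \<noteq> 0" if "a \<in> P" "r a > 0" for a
      using that r0[of a] P(2) std(8) by (auto simp: zero_set_def)
    show "S a \<noteq> b a * f a" if "a \<in> J" "r a = 0" for a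
    proof -
      have a: "a \<in> Zs" "a \<in> \<Omega>" "a \<in> disc" "a \<in> P" using that P by (auto simp: J_def)
      then have "a \<notin> zero_set B" using r0 that by simp
      then have "B a \<noteq> 0" using a by (simp add: zero_set_def)
      moreover have "B a = b a" using b[OF a(4)] a(3) that(2) by auto
      moreover have "S a / B a \<noteq> f a" using jump[OF a(1)] \<open>a \<notin> zero_set B\<close> f\<Omega> a by simp
      ultimately show ?thesis by (auto simp: field_simps)
    qed
    show "open (\<Omega> - Zs)" using assms(7) std(1) by (intro open_Diff finite_imp_closed)
    show "\<Omega> - Zs \<noteq> {}"
    proof
      assume "\<Omega> - Zs = {}"
      then have "finite \<Omega>" using std(1) by (simp add: finite_subset)
      then show False using assms(7,8) finite_imp_not_open by blast
    qed
    show "\<Omega> - Zs \<subseteq> disc" "(\<Omega> - Zs) \<inter> J = {}" using \<Omega>disc by (auto simp: J_def)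
    show "B w * f w = S w" if "w \<in> \<Omega> - Zs" for w using S\<Omega>[OF that] by simp
  qed
  then obtain zs where zs: "zs \<noteq> []" "distinct zs" "set zs \<subseteq> \<Omega>" "card I \<le> sq_neg (pick_matrix f zs)"
    by (auto simp: J_def)
  have upper: "sq_neg (pick_matrix f ws) \<le> card I" if "distinct ws" "set ws \<subseteq> \<Omega>" for ws
  proof -
    have "sq_neg (pick_matrix f ws) \<le> blaschke_degree B + card (set ws \<inter> Zs)"
      using that \<Omega>disc S\<Omega> by (intro sq_neg_pick_matrix_upper_bound[OF _ _ std(5) rank]) auto
    also have "card (set ws \<inter> Zs) \<le> card J"
      using that finJ by (intro card_mono) (auto simp: J_def)
    finally show ?thesis by (simp add: cardI)
  qed
  \<comment> \<open>The length found for the lower bound is taken as \<open>n\<close>. By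
    \<open>upper\<close> the set is bounded, hence finite, so \<open>Max\<close> is a genuine
    maximum.\<close>
  define Q where "Q = {sq_neg (pick_matrix f ws) | ws. length ws = length zs \<and> distinct ws \<and> set ws \<subseteq> \<Omega>}"
  have "sq_neg (pick_matrix f zs) = card I" using zs upper[of zs] by simp
  then have "card I \<in> Q" unfolding Q_def using zs by (intro CollectI exI[of _ zs]) auto
  moreover have "\<forall>k\<in>Q. k \<le> card I" using upper by (auto simp: Q_def)
  moreover from this have "finite Q" by (auto simp: finite_nat_set_iff_bounded_le)
  ultimately have "Max Q = card I" by (intro Max_eqI) auto
  then have "k_n (length zs) f \<Omega> = blaschke_degree B + card (Zs \<inter> \<Omega>)"
    by (simp add: k_n_def Q_def cardI J_def)
  then show ?thesis using zs(1) by blast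
qed

end
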